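(* Let $\overline{H_4}$ be the affine-Virasoro Nappi-Witten Lie algebra and let $M$ be an $\overline{H_4}$-module whose restriction to $U(\mathbb C d_0\oplus\mathbb C s)$ is free of rank one. Then $M$ is isomorphic to one of the following modules with underlying space $\mathbb C[s,d_0]$ (here $x\in\mathbb C[s,d_0]$ and $k\in\mathbb Z$ are arbitrary): (I) for some $\alpha\in\mathbb C^*$, $\lambda\in\mathbb C$ and some triple $(P,Q,R)$ with $P,Q\in\mathbb C[s]$ not both zero and $R\in\mathbb C$, from the list (i) $(g,0,0)$ with $0\neq g\in\mathbb C[s]$; (ii) $(0,g,0)$ with $0\ne g\in\mathbb C[s]$; (iii) $(a_1s+a_2,\,b,\,-a_1b)$ with $a_1,b\in\mathbb C^*$, $a_2\in\mathbb C$; (iv) $(b,\,a_1s+a_2,\,-a_1b)$ with $a_1,b\in\mathbb C^*$, $a_2\in\mathbb C$; (v) $(a,b,0)$ with $a,b\in\mathbb C^*$: $$p\otimes t^k.x=\alpha^k\tau\sigma^k(x)P,\quad q\otimes t^k.x=\alpha^k\tau^{-1}\sigma^k(x)Q,\quad r\otimes t^k.x=\alpha^k\sigma^k(x)R,$$ $$s\otimes t^k.x=\alpha^k s\,\sigma^k(x),\quad d_k.x=\alpha^k(d_0+k\lambda)\,\sigma^k(x),\quad K.x=0;$$ (II) for some $\alpha\in\mathbb C^*$ and $f\in\mathbb C[s]$: $$p\otimes t^k.x=q\otimes t^k.x=r\otimes t^k.x=0,\quad s\otimes t^k.x=\alpha^ks\,\sigma^k(x),\quad d_k.x=\alpha^k(d_0+kf(s))\,\sigma^k(x),\quad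 K.x=0.$$
   Context: $\mathbb C^*=\mathbb C\setminus\{0\}$; everything is over $\mathbb C$. The Nappi-Witten Lie algebra is $H_4=\mathbb C p\oplus\mathbb C q\oplus\mathbb C r\oplus\mathbb C s$ with brackets $[p,q]=r$, $[s,p]=p$, $[s,q]=-q$, $[r,\cdot]=0$, and invariant symmetric bilinear form with $(p,q)=1$, $(r,s)=1$ and all other pairings of basis elements zero. The affine-Virasoro Nappi-Witten Lie algebra is $\overline{H_4}=H_4\otimes\mathbb C[t^{\pm1}]\oplus\mathbb C K\oplus\bigoplus_{m\in\mathbb Z}\mathbb C d_m$ with brackets $[x\otimes t^m,y\otimes t^n]=[x,y]\otimes t^{m+n}+m(x,y)\delta_{m+n,0}K$, $[\overline{H_4},K]=0$, $[d_m,x\otimes t^n]=n\,x\otimes t^{m+n}$, $[d_m,d_n]=(n-m)d_{m+n}+\delta_{m+n,0}\frac{m^3-m}{12}K$, for $x,y\in H_4$, $m,n\in\mathbb Z$. Here $s$ is identified with $s\otimes t^0$, and $U(\mathbb C d_0\oplus\mathbb C s)=\mathbb C[s,d_0]$. Let $\tau,\sigma$ be the automorphisms of $\mathbb C[s,d_0]$ with $\tau(s)=s-1$, $\tau(d_0)=d_0$, $\sigma(s)=s$, $\sigma(d_0)=d_0-1$. *)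

theory Defs
  imports "HOL-Library.Poly_Mapping" "HOL-Computational_Algebra.Polynomial" Complex_Main
begin

section \<open>Lie algebras, their modules, and free modules\<close>

locale lie_algebra = vector_space scale
  for scale :: "'a::field \<Rightarrow> 'l::ab_group_add \<Rightarrow> 'l" +
  fixes bracket :: "'l \<Rightarrow> 'l \<Rightarrow> 'l"
  assumes bracket_linear_left: "Vector_Spaces.linear scale scale (\<lambda>x. bracket x y)"
    and bracket_linear_right: "Vector_Spaces.linear scale scale (bracket x)"
    and bracket_alternating: "bracket x x = 0"
    and bracket_jacobi:
      "bracket x (bracket y z) + bracket y (bracket z x) + bracket z (bracket x y) = 0"

locale lie_module = lie_algebra lscale bracket + mod: vector_space scale
  for lscale :: "'a::field \<Rightarrow> 'l::ab_group_add \<Rightarrow> 'l" and bracket :: "'l \<Rightarrow> 'l \<Rightarrow> 'l"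
    and scale :: "'a \<Rightarrow> 'v::ab_group_add \<Rightarrow> 'v" +
  fixes act :: "'l \<Rightarrow> 'v \<Rightarrow> 'v"
  assumes act_linear_left: "Vector_Spaces.linear lscale scale (\<lambda>x. act x v)"
    and act_linear_right: "Vector_Spaces.linear scale scale (act x)"
    and act_bracket: "act (bracket x y) v = act x (act y v) - act y (act x v)"

definition lie_module_isomorphic ::
  "('a::field \<Rightarrow> 'l::ab_group_add \<Rightarrow> 'l) \<Rightarrow> ('l \<Rightarrow> 'l \<Rightarrow> 'l) \<Rightarrow>
   ('a \<Rightarrow> 'v::ab_group_add \<Rightarrow> 'v) \<Rightarrow> ('l \<Rightarrow> 'v \<Rightarrow> 'v) \<Rightarrow>
   ('a \<Rightarrow> 'w::ab_group_add \<Rightarrow> 'w) \<Rightarrow> ('l \<Rightarrow> 'w \<Rightarrow> 'w) \<Rightarrow> bool" where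
  "lie_module_isomorphic lscale bracket scale1 act1 scale2 act2 \<longleftrightarrow>
     lie_module lscale bracket scale1 act1 \<and> lie_module lscale bracket scale2 act2 \<and>
     (\<exists>\<phi>. Vector_Spaces.linear scale1 scale2 \<phi> \<and> bij \<phi> \<and>
          (\<forall>x v. \<phi> (act1 x v) = act2 x (\<phi> v)))"

definition free_of_rank :: "('r::comm_ring_1 \<Rightarrow> 'v::ab_group_add \<Rightarrow> 'v) \<Rightarrow> nat \<Rightarrow> bool" where
  "free_of_rank scale n \<longleftrightarrow> module scale \<and>
     (\<exists>B. finite B \<and> card B = n \<and> \<not> module.dependent scale B \<and> module.span scale B = UNIV)"


section \<open>Linear extension from a basis\<close>

text \<open>The vector space with basis \<^typ>\<open>'b\<close> is \<^typ>\<open>'b \<Rightarrow>\<^sub>0 complex\<close>; the basis vector \<open>b\<close> is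
  \<open>Poly_Mapping.single b 1\<close>.\<close>

definition fscale :: "complex \<Rightarrow> ('b \<Rightarrow>\<^sub>0 complex) \<Rightarrow> ('b \<Rightarrow>\<^sub>0 complex)" where
  "fscale c = Poly_Mapping.map ((*) c)"

definition lin_ext ::
  "(complex \<Rightarrow> 'v::ab_group_add \<Rightarrow> 'v) \<Rightarrow> ('b \<Rightarrow> 'v) \<Rightarrow> ('b \<Rightarrow>\<^sub>0 complex) \<Rightarrow> 'v" where
  "lin_ext scale f x = (\<Sum>b\<in>Poly_Mapping.keys x. scale (Poly_Mapping.lookup x b) (f b))"

definition bilin_ext ::
  "(complex \<Rightarrow> 'v::ab_group_add \<Rightarrow> 'v) \<Rightarrow> ('b \<Rightarrow> 'c \<Rightarrow> 'v) \<Rightarrow>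
   ('b \<Rightarrow>\<^sub>0 complex) \<Rightarrow> ('c \<Rightarrow>\<^sub>0 complex) \<Rightarrow> 'v" where
  "bilin_ext scale f x y = lin_ext scale (\<lambda>b. lin_ext scale (f b) y) x"

lemma lookup_fscale [simp]: "Poly_Mapping.lookup (fscale c x) b = c * Poly_Mapping.lookup x b"
  unfolding fscale_def by transfer (simp add: when_def)

lemma fscale_single [simp]: "fscale c (Poly_Mapping.single b a) = Poly_Mapping.single b (c * a)"
  by (rule poly_mapping_eqI) (simp add: lookup_single when_def)

lemma vector_space_fscale: "vector_space fscale"
  by unfold_locales (auto intro!: poly_mapping_eqI simp: lookup_add algebra_simps)

lemma lin_ext_superset:
  assumes "vector_space scale" "finite A" "Poly_Mapping.keys x \<subseteq> A"
  shows "lin_ext scale f x = (\<Sum>b\<in>A. scale (Poly_Mapping.lookup x b) (f b))"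
proof -
  interpret vector_space scale by fact
  show ?thesis unfolding lin_ext_def
    by (rule sum.mono_neutral_left) (use assms in \<open>auto simp: in_keys_iff\<close>)
qed

lemma linear_lin_ext:
  assumes "vector_space scale"
  shows "Vector_Spaces.linear fscale scale (lin_ext scale f)"
proof -
  interpret vector_space scale by fact
  interpret F: vector_space "fscale :: complex \<Rightarrow> ('b \<Rightarrow>\<^sub>0 complex) \<Rightarrow> _"
    by (rule vector_space_fscale)
  show ?thesis
  proof (unfold_locales, goal_cases)
    case (1 x y)
    let ?A = "Poly_Mapping.keys x \<union> Poly_Mapping.keys y"
    have k: "Poly_Mapping.keys (x + y) \<subseteq> ?A" by (rule keys_add)
    show ?case
      using k by (simp add: lin_ext_superset[OF assms, of ?A] lookup_add scale_left_distrib
          sum.distrib)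
  next
    case (2 c x)
    have k: "Poly_Mapping.keys (fscale c x) \<subseteq> Poly_Mapping.keys x" by (auto simp: in_keys_iff)
    show ?case
      using k by (simp add: lin_ext_superset[OF assms, of "Poly_Mapping.keys x"] scale_sum_right)
  qed
qed

lemma lin_ext_single:
  assumes "vector_space scale"
  shows "lin_ext scale f (Poly_Mapping.single b a) = scale a (f b)"
proof -
  interpret vector_space scale by fact
  show ?thesis by (simp add: lin_ext_def)
qed

lemma linear_iff_pair:
  assumes "vector_space s1" "vector_space s2"
  shows "Vector_Spaces.linear s1 s2 f \<longleftrightarrow>
    (\<forall>x y. f (x + y) = f x + f y) \<and> (\<forall>c x. f (s1 c x) = s2 c (f x))"
  using assms by (simp add: Vector_Spaces.linear_iff vector_space_pair_def)

lemma basis_induct [case_names zero add single]: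
  fixes x :: "'b \<Rightarrow>\<^sub>0 complex"
  assumes "P 0" "\<And>x y. P x \<Longrightarrow> P y \<Longrightarrow> P (x + y)" "\<And>b c. P (Poly_Mapping.single b c)"
  shows "P x"
proof -
  have "P (\<Sum>b\<in>A. Poly_Mapping.single b (Poly_Mapping.lookup x b))" if "finite A" for A
    using that by (induction A) (auto simp: assms)
  moreover have "(\<Sum>b\<in>Poly_Mapping.keys x. Poly_Mapping.single b (Poly_Mapping.lookup x b)) = x"
    by (rule poly_mapping_eqI)
       (auto simp: lookup_sum lookup_single when_def in_keys_iff)
  ultimately show ?thesis using finite_keys by metis
qed


section \<open>The Lie algebra \<open>H\<^sub>4\<close> and its affine-Virasoro algebra\<close>

datatype H4_basis = Hp | Hq | Hr | Hs

type_synonym H4 = "H4_basis \<Rightarrow>\<^sub>0 complex"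

fun H4_bracket_basis :: "H4_basis \<Rightarrow> H4_basis \<Rightarrow> H4" where
  "H4_bracket_basis Hp Hq = Poly_Mapping.single Hr 1"
| "H4_bracket_basis Hq Hp = - Poly_Mapping.single Hr 1"
| "H4_bracket_basis Hs Hp = Poly_Mapping.single Hp 1"
| "H4_bracket_basis Hp Hs = - Poly_Mapping.single Hp 1"
| "H4_bracket_basis Hs Hq = - Poly_Mapping.single Hq 1"
| "H4_bracket_basis Hq Hs = Poly_Mapping.single Hq 1"
| "H4_bracket_basis _ _ = 0"

fun H4_form_basis :: "H4_basis \<Rightarrow> H4_basis \<Rightarrow> complex" where
  "H4_form_basis Hp Hq = 1"
| "H4_form_basis Hq Hp = 1"
| "H4_form_basis Hr Hs = 1"
| "H4_form_basis Hs Hr = 1"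
| "H4_form_basis _ _ = 0"

definition H4_bracket :: "H4 \<Rightarrow> H4 \<Rightarrow> H4" where
  "H4_bracket = bilin_ext fscale H4_bracket_basis"

definition H4_form :: "H4 \<Rightarrow> H4 \<Rightarrow> complex" where
  "H4_form = bilin_ext (*) H4_form_basis"

text \<open>\<open>Loop x m\<close>, \<open>Vir m\<close> and \<open>Cent\<close> stand for \<open>x \<otimes> t\<^sup>m\<close>, \<open>d\<^sub>m\<close> and \<open>K\<close>.\<close>

datatype nw_basis = Loop H4_basis int | Vir int | Cent

type_synonym nw = "nw_basis \<Rightarrow>\<^sub>0 complex"

definition loop :: "H4 \<Rightarrow> int \<Rightarrow> nw" where
  "loop x m = lin_ext fscale (\<lambda>b. Poly_Mapping.single (Loop b m) 1) x"

definition vir :: "int \<Rightarrow> nw" where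
  "vir m = Poly_Mapping.single (Vir m) 1"

definition central :: nw where
  "central = Poly_Mapping.single Cent 1"

fun nw_bracket_basis :: "nw_basis \<Rightarrow> nw_basis \<Rightarrow> nw" where
  "nw_bracket_basis (Loop x m) (Loop y n) =
     loop (H4_bracket_basis x y) (m + n)
     + fscale (if m + n = 0 then of_int m * H4_form_basis x y else 0) central"
| "nw_bracket_basis (Vir m) (Loop x n) = Poly_Mapping.single (Loop x (m + n)) (of_int n)"
| "nw_bracket_basis (Loop x n) (Vir m) = - Poly_Mapping.single (Loop x (m + n)) (of_int n)"
| "nw_bracket_basis (Vir m) (Vir n) =
     fscale (of_int (n - m)) (vir (m + n))
     + fscale (if m + n = 0 then (of_int m ^ 3 - of_int m) / 12 else 0) central"
| "nw_bracket_basis Cent _ = 0"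
| "nw_bracket_basis _ Cent = 0"

definition nw_bracket :: "nw \<Rightarrow> nw \<Rightarrow> nw" where
  "nw_bracket = bilin_ext fscale nw_bracket_basis"


section \<open>The ring \<open>\<complex>[s, d\<^sub>0]\<close> and its action\<close>

text \<open>\<open>\<complex>[s, d\<^sub>0]\<close> is represented as \<open>\<complex>[s][d\<^sub>0]\<close>: the variable of the coefficient ring
  \<^typ>\<open>complex poly\<close> is \<open>s\<close>, and the outer variable is \<open>d\<^sub>0\<close>.\<close>

type_synonym cpoly2 = "complex poly poly"

definition poly2_scale :: "complex \<Rightarrow> cpoly2 \<Rightarrow> cpoly2" where
  "poly2_scale c f = smult [:c:] f"

definition in_s :: "complex poly \<Rightarrow> cpoly2" where
  "in_s g = [:g:]"

definition var_s :: cpoly2 where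
  "var_s = [:[:0, 1:]:]"

definition var_d0 :: cpoly2 where
  "var_d0 = [:0, 1:]"

text \<open>If \<open>R\<close> acts on \<open>V\<close> through \<open>scale\<close> and the operator \<open>T\<close> is \<open>R\<close>-linear, then \<open>poly_act scale T\<close>
  is the action of \<open>R[x]\<close> on \<open>V\<close> in which \<open>x\<close> acts by \<open>T\<close>. Iterating this yields the action of
  \<open>\<complex>[s, d\<^sub>0] = U(\<complex>d\<^sub>0 \<oplus> \<complex>s)\<close> determined by the commuting operators \<open>S\<close> and \<open>D\<close> of \<open>s\<close> and \<open>d\<^sub>0\<close>.\<close>

definition poly_act ::
  "('r::comm_ring_1 \<Rightarrow> 'v::ab_group_add \<Rightarrow> 'v) \<Rightarrow> ('v \<Rightarrow> 'v) \<Rightarrow> 'r poly \<Rightarrow> 'v \<Rightarrow> 'v" where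
  "poly_act scale T p v = (\<Sum>i\<le>Polynomial.degree p. scale (coeff p i) ((T ^^ i) v))"

definition poly2_act ::
  "(complex \<Rightarrow> 'v::ab_group_add \<Rightarrow> 'v) \<Rightarrow> ('v \<Rightarrow> 'v) \<Rightarrow> ('v \<Rightarrow> 'v) \<Rightarrow> cpoly2 \<Rightarrow> 'v \<Rightarrow> 'v" where
  "poly2_act scale S D = poly_act (poly_act scale S) D"

definition nw_poly2_act ::
  "(complex \<Rightarrow> 'v::ab_group_add \<Rightarrow> 'v) \<Rightarrow> (nw \<Rightarrow> 'v \<Rightarrow> 'v) \<Rightarrow> cpoly2 \<Rightarrow> 'v \<Rightarrow> 'v" where
  "nw_poly2_act scale act =
     poly2_act scale (act (loop (Poly_Mapping.single Hs 1) 0)) (act (vir 0))"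

definition tau :: "cpoly2 \<Rightarrow> cpoly2" where
  "tau = map_poly (\<lambda>g. g \<circ>\<^sub>p [:-1, 1:])"

definition sigma :: "cpoly2 \<Rightarrow> cpoly2" where
  "sigma f = f \<circ>\<^sub>p [:-1, 1:]"

text \<open>Integer iterates of a bijection; lemmas \<open>bij_tau\<close> and \<open>bij_sigma\<close> below show that \<open>inv tau\<close>
  and \<open>int_funpow sigma k\<close> are the automorphisms \<open>s \<mapsto> s + 1\<close> and \<open>d\<^sub>0 \<mapsto> d\<^sub>0 - k\<close>.\<close>

definition int_funpow :: "('a \<Rightarrow> 'a) \<Rightarrow> int \<Rightarrow> 'a \<Rightarrow> 'a" where
  "int_funpow f k = (if k \<ge> 0 then f ^^ nat k else inv f ^^ nat (- k))"


section \<open>The modules with underlying space \<open>\<complex>[s, d\<^sub>0]\<close>\<close>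

fun type_I_basis ::
  "complex \<Rightarrow> complex \<Rightarrow> complex poly \<Rightarrow> complex poly \<Rightarrow> complex \<Rightarrow> nw_basis \<Rightarrow> cpoly2 \<Rightarrow> cpoly2"
where
  "type_I_basis \<alpha> l P Q R (Loop Hp k) x =
     poly2_scale (\<alpha> powi k) (tau (int_funpow sigma k x) * in_s P)"
| "type_I_basis \<alpha> l P Q R (Loop Hq k) x =
     poly2_scale (\<alpha> powi k) (inv tau (int_funpow sigma k x) * in_s Q)"
| "type_I_basis \<alpha> l P Q R (Loop Hr k) x =
     poly2_scale (\<alpha> powi k) (int_funpow sigma k x * in_s [:R:])"
| "type_I_basis \<alpha> l P Q R (Loop Hs k) x =
     poly2_scale (\<alpha> powi k) (var_s * int_funpow sigma k x)"
| "type_I_basis \<alpha> l P Q R (Vir k) x =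
     poly2_scale (\<alpha> powi k) ((var_d0 + in_s [:of_int k * l:]) * int_funpow sigma k x)"
| "type_I_basis \<alpha> l P Q R Cent x = 0"

definition type_I ::
  "complex \<Rightarrow> complex \<Rightarrow> complex poly \<Rightarrow> complex poly \<Rightarrow> complex \<Rightarrow> nw \<Rightarrow> cpoly2 \<Rightarrow> cpoly2" where
  "type_I \<alpha> l P Q R y x = lin_ext poly2_scale (\<lambda>b. type_I_basis \<alpha> l P Q R b x) y"

fun type_II_basis :: "complex \<Rightarrow> complex poly \<Rightarrow> nw_basis \<Rightarrow> cpoly2 \<Rightarrow> cpoly2" where
  "type_II_basis \<alpha> f (Loop Hp k) x = 0"
| "type_II_basis \<alpha> f (Loop Hq k) x = 0"
| "type_II_basis \<alpha> f (Loop Hr k) x = 0"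
| "type_II_basis \<alpha> f (Loop Hs k) x = poly2_scale (\<alpha> powi k) (var_s * int_funpow sigma k x)"
| "type_II_basis \<alpha> f (Vir k) x =
     poly2_scale (\<alpha> powi k) ((var_d0 + of_int k * in_s f) * int_funpow sigma k x)"
| "type_II_basis \<alpha> f Cent x = 0"

definition type_II :: "complex \<Rightarrow> complex poly \<Rightarrow> nw \<Rightarrow> cpoly2 \<Rightarrow> cpoly2" where
  "type_II \<alpha> f y x = lin_ext poly2_scale (\<lambda>b. type_II_basis \<alpha> f b x) y"

definition type_I_triples :: "(complex poly \<times> complex poly \<times> complex) set" where
  "type_I_triples =
     {(g, 0, 0) | g. g \<noteq> 0}
   \<union> {(0, g, 0) | g. g \<noteq> 0}
   \<union> {([:a2, a1:], [:b:], - a1 * b) | a1 a2 b. a1 \<noteq> 0 \<and> b \<noteq> 0}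
   \<union> {([:b:], [:a2, a1:], - a1 * b) | a1 a2 b. a1 \<noteq> 0 \<and> b \<noteq> 0}
   \<union> {([:a:], [:b:], 0) | a b. a \<noteq> 0 \<and> b \<noteq> 0}"


section \<open>Well-definedness\<close>

subsection \<open>The bracket of \<open>nw\<close>\<close>

lemma vector_space_times: "vector_space ((*) :: complex \<Rightarrow> complex \<Rightarrow> complex)"
  by unfold_locales (auto simp: algebra_simps)

lemma bilin_ext_simps:
  assumes "vector_space scale"
  shows "bilin_ext scale f 0 y = 0" "bilin_ext scale f x 0 = 0"
    "bilin_ext scale f (x + x') y = bilin_ext scale f x y + bilin_ext scale f x' y"
    "bilin_ext scale f x (y + y') = bilin_ext scale f x y + bilin_ext scale f x y'"
    "bilin_ext scale f (fscale c x) y = scale c (bilin_ext scale f x y)"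
    "bilin_ext scale f x (fscale c y) = scale c (bilin_ext scale f x y)"
    "bilin_ext scale f (Poly_Mapping.single a c) (Poly_Mapping.single b d) =
       scale (c * d) (f a b)"
    "bilin_ext scale f (- x) y = - bilin_ext scale f x y"
    "bilin_ext scale f x (- y) = - bilin_ext scale f x y"
    "bilin_ext scale f (x - x') y = bilin_ext scale f x y - bilin_ext scale f x' y"
    "bilin_ext scale f x (y - y') = bilin_ext scale f x y - bilin_ext scale f x y'"
proof -
  interpret vector_space scale by fact
  interpret L: Vector_Spaces.linear fscale scale "lin_ext scale g" for g :: "'d \<Rightarrow> 'a"
    by (rule linear_lin_ext) fact
  show "bilin_ext scale f 0 y = 0" "bilin_ext scale f x 0 = 0"
    "bilin_ext scale f (x + x') y = bilin_ext scale f x y + bilin_ext scale f x' y"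
    "bilin_ext scale f (fscale c x) y = scale c (bilin_ext scale f x y)"
    "bilin_ext scale f (- x) y = - bilin_ext scale f x y"
    "bilin_ext scale f (x - x') y = bilin_ext scale f x y - bilin_ext scale f x' y"
    "bilin_ext scale f (Poly_Mapping.single a c) (Poly_Mapping.single b d) =
       scale (c * d) (f a b)"
    by (simp_all add: bilin_ext_def L.zero L.add L.diff L.scale L.neg lin_ext_single[OF assms]
        lin_ext_def[of _ _ 0] lin_ext_def[of _ "\<lambda>_. 0"])
  show "bilin_ext scale f x (y + y') = bilin_ext scale f x y + bilin_ext scale f x y'"
    "bilin_ext scale f x (fscale c y) = scale c (bilin_ext scale f x y)"
    "bilin_ext scale f x (- y) = - bilin_ext scale f x y"
    "bilin_ext scale f x (y - y') = bilin_ext scale f x y - bilin_ext scale f x y'"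
    by (simp_all add: bilin_ext_def L.diff L.zero L.add L.scale L.neg)
       (simp_all add: lin_ext_def scale_right_distrib sum.distrib scale_sum_right mult.left_commute
         sum_negf scale_right_diff_distrib sum_subtractf)
qed

lemmas nw_bracket_simps = bilin_ext_simps[OF vector_space_fscale, of nw_bracket_basis,
    folded nw_bracket_def]

lemma loop_simps [simp]:
  "loop 0 m = 0" "loop (x + y) m = loop x m + loop y m" "loop (- x) m = - loop x m"
  "loop (fscale c x) m = fscale c (loop x m)"
  "loop (Poly_Mapping.single b c) m = Poly_Mapping.single (Loop b m) c"
proof -
  interpret L: Vector_Spaces.linear fscale fscale "\<lambda>x. loop x m" for m
    unfolding loop_def by (rule linear_lin_ext[OF vector_space_fscale])
  show "loop 0 m = 0" "loop (x + y) m = loop x m + loop y m" "loop (- x) m = - loop x m"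
  "loop (fscale c x) m = fscale c (loop x m)"
    by (simp_all add: L.zero L.add L.neg L.scale)
  show "loop (Poly_Mapping.single b c) m = Poly_Mapping.single (Loop b m) c"
    by (simp add: loop_def lin_ext_single[OF vector_space_fscale])
qed

lemma nw_bracket_loop:
  "nw_bracket (loop x m) (loop y n) =
     loop (H4_bracket x y) (m + n)
     + fscale (if m + n = 0 then of_int m * H4_form x y else 0) central"
proof -
  interpret F: vector_space "fscale :: complex \<Rightarrow> nw \<Rightarrow> nw"
    by (rule vector_space_fscale)
  note b = bilin_ext_simps[OF vector_space_fscale, of H4_bracket_basis, folded H4_bracket_def]
  note f = bilin_ext_simps[OF vector_space_times, of H4_form_basis, folded H4_form_def]
  show ?thesis
  proof (induction x rule: basis_induct)
    case (single a c)
    show ?case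
    proof (induction y rule: basis_induct)
      case (single a' c')
      show ?case by (simp add: nw_bracket_simps b f F.scale_right_distrib)
    qed (auto simp: nw_bracket_simps b f F.scale_left_distrib algebra_simps)
  qed (auto simp: nw_bracket_simps b f F.scale_left_distrib algebra_simps)
qed

lemma nw_bracket_vir_loop: "nw_bracket (vir m) (loop x n) = fscale (of_int n) (loop x (m + n))"
proof -
  interpret F: vector_space "fscale :: complex \<Rightarrow> nw \<Rightarrow> nw"
    by (rule vector_space_fscale)
  show ?thesis
    by (induction x rule: basis_induct)
       (simp_all add: nw_bracket_simps vir_def F.scale_right_distrib mult.commute)
qed

lemma nw_bracket_vir:
  "nw_bracket (vir m) (vir n) = fscale (of_int (n - m)) (vir (m + n))
     + fscale (if m + n = 0 then (of_int m ^ 3 - of_int m) / 12 else 0) central"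
proof -
  interpret F: vector_space "fscale :: complex \<Rightarrow> nw \<Rightarrow> nw"
    by (rule vector_space_fscale)
  show ?thesis by (simp add: nw_bracket_simps vir_def)
qed

lemma nw_bracket_central: "nw_bracket central x = 0" "nw_bracket x central = 0"
proof -
  interpret F: vector_space "fscale :: complex \<Rightarrow> nw \<Rightarrow> nw"
    by (rule vector_space_fscale)
  show "nw_bracket central x = 0"
    by (induction x rule: basis_induct) (simp_all add: nw_bracket_simps central_def)
  have "nw_bracket_basis b Cent = 0" for b by (cases b) auto
  then show "nw_bracket x central = 0"
    by (induction x rule: basis_induct) (simp_all add: nw_bracket_simps central_def)
qed

lemma fscale_minus [simp]: "fscale c (- x) = - fscale c x" "fscale (- c) x = - fscale c x"
  "fscale 0 x = 0" "fscale c 0 = 0" "fscale 1 x = x" "fscale c (fscale d x) = fscale (c * d) x"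
  by (rule poly_mapping_eqI; simp)+

lemma nw_bracket_basis_antisym: "nw_bracket_basis a b = - nw_bracket_basis b a"
proof (cases "(a, b)" rule: nw_bracket_basis.cases)
  case (1 x m y n)
  show ?thesis
  proof (cases "n = - m")
    case True
    then show ?thesis using 1
      by (cases x; cases y) (simp_all add: central_def single_uminus)
  next
    case False
    then have "m + n \<noteq> 0" "n + m \<noteq> 0" by auto
    then show ?thesis using 1 by (cases x; cases y) (simp_all add: add.commute)
  qed
next
  case (4 m n)
  show ?thesis
  proof (cases "n = - m")
    case True
    then show ?thesis using 4
      by (auto intro!: poly_mapping_eqI
          simp: central_def vir_def lookup_add lookup_single when_def algebra_simps
            add_divide_distrib diff_divide_distrib)
  next
    case False
    then have "m + n \<noteq> 0" "n + m \<noteq> 0" by auto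
    then show ?thesis using 4
      by (auto intro!: poly_mapping_eqI
          simp: vir_def lookup_add lookup_single when_def algebra_simps)
  qed
next
  case (5 c)
  then show ?thesis by (cases c) auto
qed auto

lemma nw_bracket_antisym: "nw_bracket x y = - nw_bracket y x"
proof (induction x rule: basis_induct)
  case (single a c)
  show ?case
  proof (induction y rule: basis_induct)
    case (single a' c')
    show ?case
      by (simp add: nw_bracket_simps nw_bracket_basis_antisym[of a a'] mult.commute)
  qed (simp_all add: nw_bracket_simps)
qed (simp_all add: nw_bracket_simps)

definition nw_jacobiator :: "nw \<Rightarrow> nw \<Rightarrow> nw \<Rightarrow> nw" where
  "nw_jacobiator x y z = nw_bracket x (nw_bracket y z) + nw_bracket y (nw_bracket z x)
     + nw_bracket z (nw_bracket x y)"

lemma nw_jacobiator_cyclic: "nw_jacobiator x y z = nw_jacobiator y z x"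
  by (simp add: nw_jacobiator_def add_ac)

lemma nw_jacobiator_swap: "nw_jacobiator x y z = - nw_jacobiator y x z"
proof -
  have *: "nw_bracket a (nw_bracket b c) = - nw_bracket a (nw_bracket c b)" for a b c
    by (metis nw_bracket_antisym nw_bracket_simps(9))
  show ?thesis
    using *[of x y z] *[of y z x] *[of z x y] by (simp add: nw_jacobiator_def)
qed

abbreviation nw_gen :: "nw_basis \<Rightarrow> nw" where "nw_gen b \<equiv> Poly_Mapping.single b (1::complex)"

lemma nw_jacobi_cent: "nw_jacobiator (nw_gen Cent) y z = 0"
proof -
  have "nw_bracket y (nw_bracket z central) = 0" "nw_bracket z (nw_bracket central y) = 0"
   "nw_bracket central (nw_bracket y z) = 0"
    by (simp_all add: nw_bracket_central nw_bracket_simps)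
  then show ?thesis by (simp add: central_def nw_jacobiator_def)
qed


lemma nw_jacobi_loop3: "nw_jacobiator (nw_gen (Loop x l)) (nw_gen (Loop y m)) (nw_gen (Loop z n)) = 0"
proof (cases "n = - l - m")
  case True
  show ?thesis unfolding True
   by (cases x; cases y; cases z)
    (auto simp: nw_jacobiator_def nw_bracket_simps central_def algebra_simps
        intro!: poly_mapping_eqI simp: lookup_add lookup_minus lookup_single when_def)
next
  case False
  then have [simp]: "l + (m + n) \<noteq> 0"  by auto
  show ?thesis
   by (cases x; cases y; cases z)
    (auto simp: nw_jacobiator_def nw_bracket_simps central_def algebra_simps
        intro!: poly_mapping_eqI simp: lookup_add lookup_minus lookup_single when_def)
qed

lemma nw_jacobi_vir_loop2: "nw_jacobiator (nw_gen (Vir l)) (nw_gen (Loop y m)) (nw_gen (Loop z n)) = 0"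
proof (cases "n = - l - m")
  case True
  show ?thesis unfolding True
   by (cases y; cases z)
    (auto simp: nw_jacobiator_def nw_bracket_simps central_def algebra_simps
        intro!: poly_mapping_eqI simp: lookup_add lookup_minus lookup_single when_def)
next
  case False
  then have [simp]: "l + (m + n) \<noteq> 0"  by auto
  show ?thesis
   by (cases y; cases z)
    (auto simp: nw_jacobiator_def nw_bracket_simps central_def algebra_simps
        intro!: poly_mapping_eqI simp: lookup_add lookup_minus lookup_single when_def)
qed

lemma nw_jacobi_vir2_loop: "nw_jacobiator (nw_gen (Vir l)) (nw_gen (Vir m)) (nw_gen (Loop z n)) = 0"
    by (auto simp: nw_jacobiator_def nw_bracket_simps central_def vir_def algebra_simps
        intro!: poly_mapping_eqI simp: lookup_add lookup_single when_def)

lemma nw_jacobi_vir3: "nw_jacobiator (nw_gen (Vir l)) (nw_gen (Vir m)) (nw_gen (Vir n)) = 0"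
proof (cases "n = - l - m")
  case True
  show ?thesis unfolding True
    by (auto simp: nw_jacobiator_def nw_bracket_simps central_def vir_def algebra_simps power3_eq_cube add_divide_distrib diff_divide_distrib
        intro!: poly_mapping_eqI simp: lookup_add lookup_minus lookup_single when_def)
next
  case False
  then have [simp]: "l + (m + n) \<noteq> 0"  by auto
  show ?thesis
    by (auto simp: nw_jacobiator_def nw_bracket_simps central_def vir_def algebra_simps power3_eq_cube
        intro!: poly_mapping_eqI simp: lookup_add lookup_minus lookup_single when_def)
qed

lemma linear_nw_bracket:
  "Vector_Spaces.linear fscale fscale (\<lambda>x. nw_bracket x y)"
  "Vector_Spaces.linear fscale fscale (nw_bracket x)"
  by (simp_all add: linear_iff_pair vector_space_fscale nw_bracket_simps)

lemma nw_jacobi_basis: "nw_jacobiator (nw_gen a) (nw_gen b) (nw_gen c) = 0"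
proof -
  have cyc: "nw_jacobiator x y z = nw_jacobiator z x y" for x y z
    using nw_jacobiator_cyclic by metis
  note J = nw_jacobi_cent nw_jacobi_loop3 nw_jacobi_vir_loop2 nw_jacobi_vir2_loop nw_jacobi_vir3
  have C: "nw_jacobiator y (nw_gen Cent) z = 0" "nw_jacobiator y z (nw_gen Cent) = 0" for y z
    by (subst nw_jacobiator_cyclic, rule J(1)) (subst cyc, rule J(1))
  have L: "nw_jacobiator (nw_gen (Loop x l)) (nw_gen (Vir m)) (nw_gen (Loop y n)) = 0"
    "nw_jacobiator (nw_gen (Loop x l)) (nw_gen (Loop y n)) (nw_gen (Vir m)) = 0"
    "nw_jacobiator (nw_gen (Loop x l)) (nw_gen (Vir m)) (nw_gen (Vir n)) = 0"
    "nw_jacobiator (nw_gen (Vir l)) (nw_gen (Loop y n)) (nw_gen (Vir m)) = 0" for x y l m n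
       apply (subst nw_jacobiator_cyclic, rule J)
      apply (subst cyc, rule J)
     apply (subst nw_jacobiator_cyclic, rule J)
    apply (subst cyc, rule J)
    done
  show ?thesis
    by (cases a; cases b; cases c) (simp_all only: J C L)
qed

lemma nw_jacobi: "nw_jacobiator x y z = 0"
proof -
  interpret F: vector_space "fscale :: complex \<Rightarrow> nw \<Rightarrow> nw"
    by (rule vector_space_fscale)
  have sc: "Poly_Mapping.single b c = fscale c (nw_gen b)" for b :: nw_basis and c by simp
  have lin: "nw_jacobiator x y z = 0"
    if "\<And>b. nw_jacobiator (nw_gen b) y z = 0" for x y z
  proof (induction x rule: basis_induct)
    case (single a d)
    have "nw_jacobiator (fscale d (nw_gen a)) y z = fscale d (nw_jacobiator (nw_gen a) y z)"
      unfolding nw_jacobiator_def by (simp only: nw_bracket_simps F.scale_right_distrib)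
    then show ?case by (simp add: that)
  next
    case (add x x')
    have "nw_jacobiator (x + x') y z = nw_jacobiator x y z + nw_jacobiator x' y z"
      by (simp add: nw_jacobiator_def nw_bracket_simps)
    then show ?case by (simp add: add)
  qed (simp add: nw_jacobiator_def nw_bracket_simps)
  have 1: "nw_jacobiator x (nw_gen b) (nw_gen c) = 0" for x b c
    by (rule lin) (rule nw_jacobi_basis)
  have 2: "nw_jacobiator y (nw_gen c) x = 0" for x y c
    by (rule lin) (subst nw_jacobiator_cyclic, subst nw_jacobiator_cyclic, rule 1)
  show ?thesis
    by (rule lin) (subst nw_jacobiator_cyclic, subst nw_jacobiator_cyclic, rule 2)
qed

lemma lie_algebra_nw: "lie_algebra fscale nw_bracket"
proof -
  have "nw_bracket x x = 0" for x
  proof (rule poly_mapping_eqI)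
    fix k
    have "Poly_Mapping.lookup (nw_bracket x x) k = - Poly_Mapping.lookup (nw_bracket x x) k"
      using arg_cong[OF nw_bracket_antisym[of x x], of "\<lambda>u. Poly_Mapping.lookup u k"] by simp
    then show "Poly_Mapping.lookup (nw_bracket x x) k = Poly_Mapping.lookup 0 k" by simp
  qed
  then show ?thesis
    by (intro lie_algebra.intro lie_algebra_axioms.intro vector_space_fscale linear_nw_bracket
        nw_jacobi[unfolded nw_jacobiator_def])
qed

lemma lie_module_lin_ext:
  assumes vs: "vector_space scale"
    and lin: "\<And>b. Vector_Spaces.linear scale scale (\<Phi> b)"
    and br: "\<And>a b v. lin_ext scale (\<lambda>c. \<Phi> c v) (nw_bracket_basis a b) = \<Phi> a (\<Phi> b v) - \<Phi> b (\<Phi> a v)"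
  shows "lie_module fscale nw_bracket scale (\<lambda>x v. lin_ext scale (\<lambda>b. \<Phi> b v) x)"
proof -
  interpret V: vector_space scale by fact
  interpret L: Vector_Spaces.linear scale scale "\<Phi> b" for b by (rule lin)
  let ?A = "\<lambda>x v. lin_ext scale (\<lambda>b. \<Phi> b v) x"
  interpret A: Vector_Spaces.linear fscale scale "\<lambda>x. ?A x v" for v
    by (rule linear_lin_ext[OF vs])
  have lin': "Vector_Spaces.linear scale scale (?A x)" for x
    by (auto simp: linear_iff_pair[OF vs vs] lin_ext_def L.add L.scale V.scale_right_distrib
        sum.distrib V.scale_sum_right mult.commute)
  interpret R: Vector_Spaces.linear scale scale "?A x" for x by (rule lin')
  have S: "?A (Poly_Mapping.single b c) v = scale c (\<Phi> b v)" for b c v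
    by (rule lin_ext_single[OF vs])
  have B: "?A (nw_bracket x y) v = ?A x (?A y v) - ?A y (?A x v)" for x y v
  proof (induction x rule: basis_induct)
    case (single a c)
    show ?case
    proof (induction y rule: basis_induct)
      case (single a' c')
      have 1: "?A (nw_bracket (Poly_Mapping.single a c) (Poly_Mapping.single a' c')) v
          = scale (c * c') (\<Phi> a (\<Phi> a' v) - \<Phi> a' (\<Phi> a v))"
        by (simp only: nw_bracket_simps A.scale br)
      show ?case
        unfolding 1 S by (simp add: L.scale V.scale_right_diff_distrib mult.commute)
    qed (simp_all add: nw_bracket_simps A.zero A.add L.zero lin_ext_def[of _ "\<lambda>_. 0"] R.zero R.add algebra_simps)
  qed (simp_all add: nw_bracket_simps A.zero A.add L.zero lin_ext_def[of _ "\<lambda>_. 0"] R.zero R.add algebra_simps)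
  show ?thesis
    by (intro lie_module.intro lie_algebra_nw vs lie_module_axioms.intro lin' B
        A.linear_axioms)
qed

subsection \<open>The automorphisms \<open>\<tau>\<close> and \<open>\<sigma>\<close>\<close>

definition tauk :: "int \<Rightarrow> cpoly2 \<Rightarrow> cpoly2" where
  "tauk k = map_poly (\<lambda>g. g \<circ>\<^sub>p [:- of_int k, 1:])"
definition sigmak :: "int \<Rightarrow> cpoly2 \<Rightarrow> cpoly2" where
  "sigmak k x = x \<circ>\<^sub>p [:- of_int k, 1:]"

lemma shift_shift:
  "(x :: 'a::comm_ring_1 poly) \<circ>\<^sub>p [:- of_int m, 1:] \<circ>\<^sub>p [:- of_int n, 1:] = x \<circ>\<^sub>p [:- of_int (m + n), 1:]"
  by (simp add: pcompose_assoc[symmetric] pcompose_pCons)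

lemma sigmak_simps [simp]:
  "sigmak k 0 = 0" "sigmak k 1 = 1" "sigmak 0 x = x"
  "sigmak k (x + y) = sigmak k x + sigmak k y" "sigmak k (x - y) = sigmak k x - sigmak k y"
  "sigmak k (x * y) = sigmak k x * sigmak k y" "sigmak k [:c:] = [:c:]"
  "sigmak k (smult c x) = smult c (sigmak k x)"
  by (simp_all add: sigmak_def pcompose_add pcompose_diff pcompose_mult pcompose_smult pcompose_1)

lemma sigmak_sigmak [simp]: "sigmak m (sigmak n x) = sigmak (m + n) x"
  using shift_shift[of x n m] by (simp only: sigmak_def add.commute)

lemma sigmak_pCons: "sigmak k (pCons c x) = [:c:] + [:- of_int k, 1:] * sigmak k x"
  by (simp only: sigmak_def pcompose_pCons)

lemma tauk_simps [simp]:
  "tauk k 0 = 0" "tauk k 1 = 1" "tauk 0 x = x"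
  "tauk k (x + y) = tauk k x + tauk k y" "tauk k (x - y) = tauk k x - tauk k y"
  "tauk k (pCons c x) = pCons (c \<circ>\<^sub>p [:- of_int k, 1:]) (tauk k x)"
  by (auto intro!: poly_eqI simp: tauk_def coeff_map_poly pcompose_add pcompose_diff pcompose_1
     coeff_pCons map_poly_pCons split: nat.splits)

lemma tauk_mult [simp]: "tauk k (x * y) = tauk k x * tauk k y"
  by (rule poly_eqI) (simp add: tauk_def coeff_map_poly coeff_mult pcompose_sum pcompose_mult)

lemma tauk_tauk [simp]: "tauk m (tauk n x) = tauk (m + n) x"
proof (rule poly_eqI)
  fix i
  show "coeff (tauk m (tauk n x)) i = coeff (tauk (m + n) x) i"
    using shift_shift[of "coeff x i" n m]
    by (simp only: tauk_def coeff_map_poly pcompose_0 add.commute)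
qed

lemma tauk_sigmak: "tauk k (sigmak m x) = sigmak m (tauk k x)"
proof (induction x)
  case (pCons a x)
  have 1: "tauk k [:- of_int m, 1:] = [:- of_int m, 1:]"
    by (simp add: pcompose_1 of_int_poly pcompose_uminus)
  have "tauk k (sigmak m (pCons a x)) = tauk k [:a:] + tauk k [:- of_int m, 1:] * tauk k (sigmak m x)"
    by (simp only: sigmak_pCons tauk_simps(4) tauk_mult)
  also have "\<dots> = sigmak m (tauk k (pCons a x))"
    unfolding 1 pCons by (simp only: sigmak_pCons tauk_simps)
  finally show ?case .
qed simp

lemma bij_tau: "bij tau" "inv tau = tauk (-1)" "tau = tauk 1"
proof -
  show 1: "tau = tauk 1" by (simp add: tau_def tauk_def)
  show "bij tau"
    unfolding 1 by (rule bij_betw_byWitness[of _ "tauk (-1)"]) auto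
  show "inv tau = tauk (-1)"
    unfolding 1 by (rule inv_equality) auto
qed

lemma bij_sigma: "bij sigma" "int_funpow sigma k = sigmak k"
proof -
  have 1: "sigma = sigmak 1" by (simp add: fun_eq_iff sigma_def sigmak_def)
  show "bij sigma"
    unfolding 1 by (rule bij_betw_byWitness[of _ "sigmak (-1)"]) auto
  have 2: "inv sigma = sigmak (-1)"
    unfolding 1 by (rule inv_equality) auto
  have "(sigmak l ^^ n) x = sigmak (int n * l) x" for l n x
    by (induction n) (auto simp: algebra_simps)
  then show "int_funpow sigma k = sigmak k"
    unfolding int_funpow_def 2 unfolding 1 by auto
qed


subsection \<open>The two families are modules\<close>

lemma in_s_one [simp]: "in_s [:1:] = 1"
  by (simp add: in_s_def one_pCons)

lemma poly2_scale_conv: "poly2_scale c x = in_s [:c:] * x"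
  by (simp add: poly2_scale_def in_s_def)

lemma in_s_simps [simp]:
  "in_s 0 = 0" "in_s (g + h) = in_s g + in_s h" "in_s (g - h) = in_s g - in_s h"
  "in_s (g * h) = in_s g * in_s h" "in_s (- g) = - in_s g" "in_s 1 = 1"
  "sigmak k (in_s g) = in_s g" "tauk k (in_s g) = in_s (g \<circ>\<^sub>p [:- of_int k, 1:])"
  by (simp_all add: in_s_def one_pCons)

lemma in_s_const:
  "in_s [:a * b:] = in_s [:a:] * in_s [:b:]" "in_s [:a + b:] = in_s [:a:] + in_s [:b:]"
  "in_s [:a - b:] = in_s [:a:] - in_s [:b:]" "in_s [:- a:] = - in_s [:a:]"
  "in_s [:of_int k:] = of_int k" "in_s [:0:] = 0"
  by (simp_all add: in_s_def of_int_poly)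

lemma shift_vars [simp]:
  "sigmak k var_s = var_s" "sigmak k var_d0 = var_d0 - of_int k" "sigmak k (of_int l) = of_int l"
  "tauk k var_s = var_s - of_int k" "tauk k var_d0 = var_d0" "tauk k (of_int l) = of_int l"
  by (simp_all add: var_s_def var_d0_def sigmak_def of_int_poly pcompose_pCons pcompose_1)

lemma vector_space_poly2_scale: "vector_space poly2_scale"
  by unfold_locales (simp_all add: poly2_scale_def smult_add_right
      mult.commute flip: smult_add_left one_pCons)

lemma type_I_basis_sigmak:
  "type_I_basis \<alpha> l P Q R (Loop Hp k) x = in_s [:\<alpha> powi k:] * tauk 1 (sigmak k x) * in_s P"
  "type_I_basis \<alpha> l P Q R (Loop Hq k) x = in_s [:\<alpha> powi k:] * tauk (-1) (sigmak k x) * in_s Q"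
  "type_I_basis \<alpha> l P Q R (Loop Hr k) x = in_s [:\<alpha> powi k:] * sigmak k x * in_s [:R:]"
  "type_I_basis \<alpha> l P Q R (Loop Hs k) x = in_s [:\<alpha> powi k:] * var_s * sigmak k x"
  "type_I_basis \<alpha> l P Q R (Vir k) x =
     in_s [:\<alpha> powi k:] * (var_d0 + of_int k * in_s [:l:]) * sigmak k x"
  "type_I_basis \<alpha> l P Q R Cent x = 0"
  unfolding type_I_basis.simps poly2_scale_conv bij_tau(2) bij_sigma(2)
  by (simp_all only: bij_tau(3) in_s_const mult.assoc)

lemma type_II_basis_sigmak:
  "type_II_basis \<alpha> f (Loop Hp k) x = 0" "type_II_basis \<alpha> f (Loop Hq k) x = 0"
  "type_II_basis \<alpha> f (Loop Hr k) x = 0"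
  "type_II_basis \<alpha> f (Loop Hs k) x = in_s [:\<alpha> powi k:] * var_s * sigmak k x"
  "type_II_basis \<alpha> f (Vir k) x = in_s [:\<alpha> powi k:] * (var_d0 + of_int k * in_s f) * sigmak k x"
  "type_II_basis \<alpha> f Cent x = 0"
  unfolding type_II_basis.simps poly2_scale_conv bij_sigma(2) by (simp_all only: mult.assoc)

lemma lie_module_family:
  fixes T :: "nw_basis \<Rightarrow> cpoly2 \<Rightarrow> cpoly2" and P Q F :: "complex poly"
  assumes "\<alpha> \<noteq> 0"
    and *: "in_s (Q \<circ>\<^sub>p [:-1, 1:]) * in_s P = in_s (P \<circ>\<^sub>p [:1, 1:]) * in_s Q + in_s [:R:]"
    and F: "P = 0 \<and> Q = 0 \<or> (\<exists>l. F = [:l:])"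
    and T: "\<And>k x. T (Loop Hp k) x = in_s [:\<alpha> powi k:] * tauk 1 (sigmak k x) * in_s P"
      "\<And>k x. T (Loop Hq k) x = in_s [:\<alpha> powi k:] * tauk (-1) (sigmak k x) * in_s Q"
      "\<And>k x. T (Loop Hr k) x = in_s [:\<alpha> powi k:] * sigmak k x * in_s [:R:]"
      "\<And>k x. T (Loop Hs k) x = in_s [:\<alpha> powi k:] * var_s * sigmak k x"
      "\<And>k x. T (Vir k) x = in_s [:\<alpha> powi k:] * (var_d0 + of_int k * in_s F) * sigmak k x"
      "\<And>x. T Cent x = 0"
  shows "lie_module fscale nw_bracket poly2_scale (\<lambda>y x. lin_ext poly2_scale (\<lambda>b. T b x) y)"
proof -
    have F': "in_s P * in_s (F \<circ>\<^sub>p [:-1, 1:]) = in_s P * in_s F"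
    "in_s Q * in_s (F \<circ>\<^sub>p [:1, 1:]) = in_s Q * in_s F" "in_s P = 0 \<and> in_s Q = 0 \<or> (\<exists>l. F = [:l:])"
    using F by auto
  have pw: "\<alpha> powi (m + n) = \<alpha> powi m * \<alpha> powi n" for m n
    using assms(1) by (simp add: power_int_add)
  interpret L: Vector_Spaces.linear fscale poly2_scale "\<lambda>y. lin_ext poly2_scale (\<lambda>b. T b x) y" for x
    by (rule linear_lin_ext[OF vector_space_poly2_scale])
  have S: "lin_ext poly2_scale (\<lambda>b. T b x) (Poly_Mapping.single b c) = in_s [:c:] * T b x" for b c x
    by (simp add: lin_ext_single[OF vector_space_poly2_scale] poly2_scale_conv)
  have lin: "Vector_Spaces.linear poly2_scale poly2_scale (T b)" for b
    unfolding linear_iff_pair[OF vector_space_poly2_scale vector_space_poly2_scale]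
  proof (cases b)
    case (Loop y k)
    then show "(\<forall>x y. T b (x + y) = T b x + T b y) \<and>
        (\<forall>c x. T b (poly2_scale c x) = poly2_scale c (T b x))"
      by (cases y) (auto simp: poly2_scale_conv T ring_distribs)
  qed (auto simp: poly2_scale_conv T ring_distribs)
  interpret TL: Vector_Spaces.linear poly2_scale poly2_scale "T b" for b
    by (rule lin)
  show ?thesis
  proof (rule lie_module_lin_ext[OF vector_space_poly2_scale lin])
    fix a b x
    have cen: "lin_ext poly2_scale (\<lambda>b. T b x) (fscale c central) = 0" for c
      by (simp add: central_def S T)
    show "lin_ext poly2_scale (\<lambda>c. T c x) (nw_bracket_basis a b) = T a (T b x) - T b (T a x)"
    proof (cases "(a, b)" rule: nw_bracket_basis.cases)
      case (1 y m z n)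
      have R: "in_s [:R:] = in_s (Q \<circ>\<^sub>p [:-1, 1:]) * in_s P - in_s (P \<circ>\<^sub>p [:1, 1:]) * in_s Q"
        using * by simp
      have e: "lin_ext poly2_scale (\<lambda>c. T c x) (nw_bracket_basis a b) =
          lin_ext poly2_scale (\<lambda>c. T c x) (loop (H4_bracket_basis y z) (m + n))"
        using 1 by (simp only: prod.inject nw_bracket_basis.simps L.add cen add_0_right)
      from 1 have ab: "a = Loop y m" "b = Loop z n" by auto
      show ?thesis
        unfolding e unfolding ab
        by (cases y; cases z)
           (simp_all add: L.neg L.zero S T pw in_s_const tauk_sigmak algebra_simps,
            simp_all add: R algebra_simps)
    next
      case (2 m y n)
      then show ?thesis
        using F' by (cases y) (auto simp: L.add L.neg L.zero cen S T pw in_s_const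
          tauk_sigmak algebra_simps)
    next
      case (3 y n m)
      then show ?thesis
        using F' by (cases y) (auto simp: L.add L.neg L.zero cen S T pw in_s_const
          tauk_sigmak algebra_simps)
    next
      case (4 m n)
      then show ?thesis
        by (simp add: L.add vir_def cen S T pw in_s_const algebra_simps)
    next
      case (5 c)
      then show ?thesis
        by (auto simp: L.zero T(6) TL.zero)
    qed (auto simp: L.zero T(6) TL.zero)
  qed
qed


lemma lie_module_type_I:
  assumes "\<alpha> \<noteq> 0" "(P, Q, R) \<in> type_I_triples"
  shows "lie_module fscale nw_bracket poly2_scale (type_I \<alpha> l P Q R)"
proof -
  have *: "in_s (Q \<circ>\<^sub>p [:-1, 1:]) * in_s P = in_s (P \<circ>\<^sub>p [:1, 1:]) * in_s Q + in_s [:R:]"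
    using assms(2) unfolding type_I_triples_def in_s_simps(2,4)[symmetric]
    by (auto simp: pcompose_pCons in_s_def algebra_simps)
  show ?thesis
    unfolding type_I_def[abs_def]
    by (rule lie_module_family[OF assms(1) *, of "[:l:]"]) (auto simp only: type_I_basis_sigmak)
qed

lemma lie_module_type_II:
  assumes "\<alpha> \<noteq> 0"
  shows "lie_module fscale nw_bracket poly2_scale (type_II \<alpha> f)"
  unfolding type_II_def[abs_def]
  by (rule lie_module_family[OF assms, of 0 0 0 f])
     (simp_all only: type_II_basis_sigmak, simp_all add: in_s_const)


subsection \<open>The action of \<open>\<complex>[s, d\<^sub>0]\<close> is a module structure\<close>

lemma poly_act_superset:
  assumes "module sc" "Polynomial.degree p \<le> n"
  shows "poly_act sc T p v = (\<Sum>i\<le>n. sc (coeff p i) ((T ^^ i) v))"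
proof -
  interpret module sc by fact
  show ?thesis unfolding poly_act_def
    by (rule sum.mono_neutral_left) (use assms in \<open>auto simp: coeff_eq_0\<close>)
qed

lemma module_poly_act:
  assumes m: "module sc"
    and T: "\<And>x y. T (x + y) = T x + T y" "\<And>c x. T (sc c x) = sc c (T x)"
  shows "module (poly_act sc T)"
    and "\<And>U p x. (\<And>x y. U (x + y) = U x + U y) \<Longrightarrow> (\<And>c x. U (sc c x) = sc c (U x)) \<Longrightarrow>
      (\<And>x. U (T x) = T (U x)) \<Longrightarrow> U (poly_act sc T p x) = poly_act sc T p (U x)"
proof -
  interpret module sc by fact
  interpret T: additive T by unfold_locales (rule T)
  have Tp: "(T ^^ n) (x + y) = (T ^^ n) x + (T ^^ n) y" "(T ^^ n) (sc c x) = sc c ((T ^^ n) x)"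
    for n x y c by (induction n) (auto simp: T)
  have add_r: "poly_act sc T p (x + y) = poly_act sc T p x + poly_act sc T p y" for p x y
    by (simp add: poly_act_def Tp scale_right_distrib sum.distrib)
  have add_l: "poly_act sc T (p + q) x = poly_act sc T p x + poly_act sc T q x" for p q x
  proof -
    have d: "Polynomial.degree p \<le> max (Polynomial.degree p) (Polynomial.degree q)"
      "Polynomial.degree q \<le> max (Polynomial.degree p) (Polynomial.degree q)"
      "Polynomial.degree (p + q) \<le> max (Polynomial.degree p) (Polynomial.degree q)"
      using degree_add_le_max by auto
    show ?thesis
      unfolding d[THEN poly_act_superset[OF m]] by (simp add: scale_left_distrib sum.distrib)
  qed
  have pC: "poly_act sc T (pCons a p) x = sc a x + T (poly_act sc T p x)" for a p x
  proof -
    have d: "Polynomial.degree (pCons a p) \<le> Suc (Polynomial.degree p)" by (simp add: degree_pCons_le)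
    show ?thesis
      unfolding poly_act_superset[OF m d] sum.atMost_Suc_shift
      by (simp add: poly_act_def T.sum T)
  qed
  have z: "poly_act sc T 0 x = 0" for x by (simp add: poly_act_def)
  have sm: "poly_act sc T (Polynomial.smult a p) x = sc a (poly_act sc T p x)" for a p x
    by (induction p) (simp_all add: z pC T scale_right_distrib)
  have mult: "poly_act sc T (p * q) x = poly_act sc T p (poly_act sc T q x)" for p q x
    by (induction p) (simp_all add: z pC T add_l sm)
  show "module (poly_act sc T)"
    by unfold_locales (simp_all add: add_l add_r mult, simp add: poly_act_def)
  fix U p x assume U: "\<And>x y. U (x + y) = U x + U y" "\<And>c x. U (sc c x) = sc c (U x)"
      "\<And>x. U (T x) = T (U x)"
  interpret U: additive U by unfold_locales (rule U)
  show "U (poly_act sc T p x) = poly_act sc T p (U x)"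
    by (induction p) (simp_all add: z pC U U.zero)
qed

lemma module_nw_poly2_act:
  assumes "lie_module fscale nw_bracket scale act"
  shows "module (nw_poly2_act scale act)"
proof -
  interpret lie_module fscale nw_bracket scale act by fact
  interpret L: Vector_Spaces.linear fscale scale "\<lambda>x. act x v" for v by (rule act_linear_left)
  interpret R: Vector_Spaces.linear scale scale "act x" for x by (rule act_linear_right)
  let ?s = "loop (Poly_Mapping.single Hs 1) 0"
  have "act (vir 0) (act ?s v) = act ?s (act (vir 0) v)" for v
    using act_bracket[of "vir 0" ?s v] by (simp add: nw_bracket_vir_loop L.zero del: loop_simps)
  then show ?thesis
    unfolding nw_poly2_act_def poly2_act_def
    by (intro module_poly_act) (auto simp: R.add R.scale mod.module_axioms intro: module_poly_act)
qed

end

theory Submission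
  imports Defs
begin

text \<open>
  Identify the module with \<open>\<complex>[s, d\<^sub>0]\<close> through a free generator, so that \<open>s\<close> and \<open>d\<^sub>0\<close> act by
  multiplication (\<open>polynomial_model\<close>). A basis vector \<open>b\<close> with \<open>[s, b] = j b\<close> and \<open>[d\<^sub>0, b] = k b\<close>
  then satisfies \<open>b s = (s - j) b\<close> and \<open>b d\<^sub>0 = (d\<^sub>0 - k) b\<close>, hence acts as
  \<open>x \<mapsto> \<tau>\<^sup>j \<sigma>\<^sup>k(x) X\<^sub>b\<close>, where the polynomial \<open>X\<^sub>b = b.1\<close> is called its symbol (\<open>act_gen\<close>). Every
  bracket becomes a difference equation between symbols, and the task is to solve these equations.

  The symbols of \<open>s \<otimes> t\<^sup>k\<close> are the key. As \<open>s \<otimes> t\<^sup>k\<close> and \<open>s \<otimes> t\<^sup>-\<^sup>k\<close> commute, a product of a shift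
  of one symbol with the other one is invariant under a shift of \<open>d\<^sub>0\<close>, so it does not involve
  \<open>d\<^sub>0\<close>; it is nonzero since \<open>[d\<^sub>-\<^sub>k, s \<otimes> t\<^sup>k] = k s\<close>. Thus all these symbols lie in \<open>\<complex>[s]\<close>
  (\<open>symbol_s_in_s\<close>). The brackets \<open>[d\<^sub>m, s \<otimes> t\<^sup>n]\<close> now force the symbol of \<open>d\<^sub>m\<close> to be of degree one in
  \<open>d\<^sub>0\<close> and produce the scalar \<open>\<alpha>\<close>, a unit of \<open>\<complex>[s]\<close>; the Virasoro relations reduce to the equation
  of a Witt algebra cocycle, whose only solutions are linear in \<open>m\<close> and leave no room for \<open>K\<close>
  (\<open>witt_cocycle_linear\<close>, \<open>symbols_of_s_vir_central\<close>).

  The symbols of \<open>p \<otimes> t\<^sup>k\<close> and \<open>q \<otimes> t\<^sup>k\<close> are determined by those for \<open>k = 0\<close>. Applying the commutators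
  with \<open>s \<otimes> t\<close> and \<open>s \<otimes> t\<^sup>-\<^sup>1\<close> one after the other shows that the latter have vanishing second
  difference in \<open>d\<^sub>0\<close>, and the commutators with \<open>d\<^sub>1\<close> and \<open>d\<^sub>-\<^sub>1\<close> then remove the linear term
  (\<open>symbol_of_charged_loop\<close>). What remains are \<open>P, Q \<in> \<complex>[s]\<close> with
  \<open>R = P(s) Q(s - 1) - P(s + 1) Q(s)\<close> the symbol of \<open>r\<close>. When \<open>P\<close> and \<open>Q\<close> are both nonzero, \<open>R\<close> is
  constant and \<open>P(s + 1) Q(s)\<close> has constant difference; so \<open>deg P + deg Q \<le> 1\<close>, which is the list of
  triples (\<open>type_I_triples_of_relations\<close>). A nonzero \<open>P\<close> or \<open>Q\<close> also makes \<open>f\<close> constant, and this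
  separates the two families.
\<close>

section \<open>Polynomials and their shifts\<close>

text \<open>Such a polynomial takes the value \<open>p(0)\<close> at the infinitely many points \<open>n c\<close>.\<close>
lemma degree_0_of_shift_invariant:
  fixes p :: "'a::{idom,ring_char_0} poly"
  assumes "p \<circ>\<^sub>p [:c, 1:] = p" "c \<noteq> 0"
  shows "degree p = 0"
proof -
  have val: "poly p (of_nat n * c) = poly p 0" for n
  proof (induction n)
    case (Suc n)
    have "poly p (of_nat (Suc n) * c) = poly (p \<circ>\<^sub>p [:c, 1:]) (of_nat n * c)"
      by (simp add: poly_pcompose algebra_simps)
    then show ?case using assms(1) Suc by simp
  qed simp
  have "range (\<lambda>n. of_nat n * c) \<subseteq> {x. poly (p - [:poly p 0:]) x = 0}"
    using val by auto
  moreover have "infinite (range (\<lambda>n::nat. of_nat n * c))"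
    using assms(2) by (intro range_inj_infinite) (auto simp: inj_on_def)
  ultimately have "infinite {x. poly (p - [:poly p 0:]) x = 0}"
    using finite_subset by blast
  then have "p - [:poly p 0:] = 0"
    using poly_roots_finite by blast
  then show ?thesis
    by (metis degree_pCons_0 eq_iff_diff_eq_0)
qed

lemma in_s_inject [simp]: "in_s g = in_s h \<longleftrightarrow> g = h"
  by (simp add: in_s_def)

lemma in_s_eq_0_iff [simp]: "in_s g = 0 \<longleftrightarrow> g = 0"
  by (simp add: in_s_def)

lemma in_s_of_int [simp]: "in_s (of_int k) = of_int k"
  by (simp add: in_s_def of_int_poly)

lemma in_s_of_degree_0: "degree x = 0 \<Longrightarrow> \<exists>g. x = in_s g"
  unfolding in_s_def by (metis degree_0_id)

lemma in_s_of_sigmak_invariant: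
  assumes "sigmak k x = x" "k \<noteq> 0"
  obtains g where "x = in_s g"
proof -
  have "degree x = 0"
    using assms by (intro degree_0_of_shift_invariant[of _ "- of_int k"]) (auto simp: sigmak_def)
  then show ?thesis using that in_s_of_degree_0 by blast
qed

text \<open>Subtracting \<open>a d\<^sub>0\<close> makes \<open>x\<close> invariant under the shift.\<close>
lemma affine_of_constant_difference:
  assumes "x - sigmak 1 x = in_s a"
  obtains b where "x = in_s a * var_d0 + in_s b"
proof -
  have "sigmak 1 (x - in_s a * var_d0) = x - in_s a * var_d0"
    using assms by (simp add: algebra_simps)
  then obtain b where "x - in_s a * var_d0 = in_s b"
    by (rule in_s_of_sigmak_invariant) auto
  then show ?thesis by (intro that[of b]) (simp add: algebra_simps)
qed

text \<open>Degrees in \<open>d\<^sub>0\<close> add up, so a factor of a nonzero element of \<open>\<complex>[s]\<close> does not involve \<open>d\<^sub>0\<close>.\<close>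
lemma in_s_factor:
  assumes "x * y = in_s g" "g \<noteq> 0"
  obtains h where "x = in_s h"
proof -
  have "x \<noteq> 0" "y \<noteq> 0" using assms by auto
  then have "degree x + degree y = 0"
    using assms(1) degree_mult_eq[of x y] by (simp add: in_s_def)
  then show ?thesis using that in_s_of_degree_0 by auto
qed

lemma affine_eq_0: "in_s a * var_d0 + in_s b = 0 \<Longrightarrow> a = 0 \<and> b = 0"
  by (simp add: in_s_def var_d0_def)

lemma cpoly2_induct [case_names const var_s var_d0 add]:
  fixes x :: cpoly2
  assumes "\<And>c. P (in_s [:c:])" "\<And>x. P x \<Longrightarrow> P (var_s * x)" "\<And>x. P x \<Longrightarrow> P (var_d0 * x)"
    "\<And>x y. P x \<Longrightarrow> P y \<Longrightarrow> P (x + y)"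
  shows "P x"
proof -
  have s: "P (in_s g)" for g
  proof (induction g)
    case 0
    show ?case using assms(1)[of 0] by simp
  next
    case (pCons c g)
    have "in_s (pCons c g) = in_s [:c:] + var_s * in_s g"
      by (simp add: in_s_def var_s_def)
    then show ?case using assms pCons by metis
  qed
  show ?thesis
  proof (induction x)
    case 0
    show ?case using s[of 0] by simp
  next
    case (pCons g x)
    have "pCons g x = in_s g + var_d0 * x"
      by (simp add: in_s_def var_d0_def)
    then show ?case using assms s pCons by metis
  qed
qed

section \<open>A cocycle equation of the Witt algebra\<close>

text \<open>Small indices give \<open>g(\<plusminus>1)\<close> and \<open>g(\<plusminus>2)\<close> as multiples of \<open>g(1)\<close>; then \<open>(m, n) = (2, -2)\<close> is the
  first instance in which the coefficient \<open>m\<^sup>3 - m\<close> is visible, and it gives \<open>\<kappa> = 0\<close>. All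
  further values follow by induction from \<open>m = 1\<close>.\<close>
lemma witt_cocycle_linear:
  fixes g :: "int \<Rightarrow> 'a::{idom,ring_char_0}"
  assumes cocycle: "\<And>m n. of_int n * g n - of_int m * g m =
      of_int (n - m) * g (m + n) + (if m + n = 0 then of_int (m ^ 3 - m) * \<kappa> else 0)"
    and g0: "g 0 = 0"
  shows "\<kappa> = 0" "g k = of_int k * g 1"
proof -
  have gm1: "g (-1) = - g 1"
    using cocycle[of 1 "-1"] g0 by (simp add: add_eq_0_iff)
  have g2: "g 2 = 2 * g 1"
    using cocycle[of "-1" 2] gm1 by simp
  have "2 * (g (-2) + 2 * g 1) = 0"
    using cocycle[of 1 "-2"] gm1 by (simp add: algebra_simps)
  then have gm2: "g (-2) = - (2 * g 1)"
    by (simp only: mult_eq_0_iff) (simp add: eq_neg_iff_add_eq_0)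
  show \<kappa>: "\<kappa> = 0"
    using cocycle[of 2 "-2"] g0 g2 gm2 by simp
  have gen: "g (int n) = of_nat n * g 1" for n
  proof (induction n)
    case (Suc n)
    \<comment> \<open>The equation for \<open>(1, n)\<close> has the factor \<open>n - 1\<close> in front of \<open>g(n + 1)\<close>, so it does not
      determine \<open>g(2)\<close>, which came from \<open>(-1, 2)\<close>.\<close>
    consider "n = 0" | "n = 1" | "n \<ge> 2" by linarith
    then show ?case
    proof cases
      case 3
      have "of_int (int n - 1) * g (int (Suc n)) = of_int (int n - 1) * (of_nat (Suc n) * g 1)"
        using cocycle[of 1 "int n"] Suc \<kappa> by (simp add: algebra_simps)
      then show ?thesis using 3 by (subst (asm) mult_left_cancel) simp_all
    qed (use g2 in simp_all)
  qed (simp add: g0)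
  have neg: "g (- k) = - g k" for k
  proof (cases "k = 0")
    case False
    have "of_int k * (g (- k) + g k) = 0"
      using cocycle[of k "-k"] \<kappa> g0 by (simp add: algebra_simps)
    then show ?thesis using False by (simp add: eq_neg_iff_add_eq_0)
  qed (simp add: g0)
  show "g k = of_int k * g 1"
    using gen[of "nat k"] gen[of "nat (-k)"] neg[of "k"] by (cases "k \<ge> 0") auto
qed

section \<open>Modules on polynomials and their symbols\<close>

text \<open>Charge and mode are the eigenvalues of \<open>ad s\<close> and \<open>ad d\<^sub>0\<close> on the basis vectors.\<close>
fun H4_charge :: "H4_basis \<Rightarrow> int" where
  "H4_charge Hp = 1"
| "H4_charge Hq = -1"
| "H4_charge _ = 0"

fun charge :: "nw_basis \<Rightarrow> int" where
  "charge (Loop x k) = H4_charge x"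
| "charge _ = 0"

fun mode :: "nw_basis \<Rightarrow> int" where
  "mode (Loop x k) = k"
| "mode (Vir k) = k"
| "mode Cent = 0"

locale polynomial_nw_module = lie_module fscale nw_bracket poly2_scale act
  for act :: "nw \<Rightarrow> cpoly2 \<Rightarrow> cpoly2" +
  assumes act_s: "act (nw_gen (Loop Hs 0)) x = var_s * x"
    and act_d0: "act (nw_gen (Vir 0)) x = var_d0 * x"
begin

abbreviation symbol :: "nw_basis \<Rightarrow> cpoly2" where "symbol b \<equiv> act (nw_gen b) 1"

lemma act_simps [simp]:
  "act 0 v = 0" "act (x + y) v = act x v + act y v" "act (- x) v = - act x v"
  "act (fscale c x) v = poly2_scale c (act x v)"
  "act x 0 = 0" "act x (v + w) = act x v + act x w"
  "act x (poly2_scale c v) = poly2_scale c (act x v)"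
proof -
  interpret L: Vector_Spaces.linear fscale poly2_scale "\<lambda>x. act x v" for v by (rule act_linear_left)
  interpret R: Vector_Spaces.linear poly2_scale poly2_scale "act x" for x by (rule act_linear_right)
  show "act 0 v = 0" "act (x + y) v = act x v + act y v" "act (- x) v = - act x v"
  "act (fscale c x) v = poly2_scale c (act x v)"
  "act x 0 = 0" "act x (v + w) = act x v + act x w"
  "act x (poly2_scale c v) = poly2_scale c (act x v)"
    by (rule L.zero L.add L.neg L.scale R.zero R.add R.scale)+
qed

lemma act_single: "act (Poly_Mapping.single b c) v = poly2_scale c (act (nw_gen b) v)"
  using act_simps(4)[of c "nw_gen b" v] by simp

lemma act_bracket_basis:
  "act (nw_bracket_basis a b) v =
     act (nw_gen a) (act (nw_gen b) v) - act (nw_gen b) (act (nw_gen a) v)"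
  using act_bracket[of "nw_gen a" "nw_gen b" v] by (simp add: nw_bracket_simps)

lemma nw_bracket_basis_Cartan:
  "nw_bracket_basis (Loop Hs 0) b = fscale (of_int (charge b)) (nw_gen b)"
  "nw_bracket_basis (Vir 0) b = fscale (of_int (mode b)) (nw_gen b)"
  subgoal
  proof (cases b)
    case (Loop x k)
    then show ?thesis by (cases x) (simp_all add: single_uminus central_def)
  qed simp_all
  subgoal by (cases b) (simp_all add: vir_def central_def)
  done

text \<open>Moving \<open>s\<close> or \<open>d\<^sub>0\<close> past a basis vector shifts it by the charge or the mode, so the operator is
  determined by its value at \<open>1\<close>.\<close>
lemma act_gen: "act (nw_gen b) x = tauk (charge b) (sigmak (mode b) x) * symbol b"
proof (induction x rule: cpoly2_induct)
  case (const c)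
  have "act (nw_gen b) (in_s [:c:]) = poly2_scale c (symbol b)"
    using act_simps(7)[of "nw_gen b" c 1] by (simp add: poly2_scale_conv)
  then show ?case by (simp add: poly2_scale_conv)
next
  case (var_s x)
  have "act (nw_gen b) (var_s * x) = (var_s - of_int (charge b)) * act (nw_gen b) x"
    using act_bracket_basis[of "Loop Hs 0" b x]
    by (simp add: nw_bracket_basis_Cartan act_s poly2_scale_conv in_s_const algebra_simps
      del: nw_bracket_basis.simps fscale_single)
  then show ?case by (simp add: var_s)
next
  case (var_d0 x)
  have "act (nw_gen b) (var_d0 * x) = (var_d0 - of_int (mode b)) * act (nw_gen b) x"
    using act_bracket_basis[of "Vir 0" b x]
    by (simp add: nw_bracket_basis_Cartan act_d0 poly2_scale_conv in_s_const algebra_simps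
      del: nw_bracket_basis.simps fscale_single)
  then show ?case by (simp add: var_d0)
qed (simp add: ring_distribs)

lemma bracket_relation:
  "act (nw_bracket_basis a b) 1 =
     tauk (charge a) (sigmak (mode a) (symbol b)) * symbol a
     - tauk (charge b) (sigmak (mode b) (symbol a)) * symbol b"
  unfolding act_bracket_basis by (simp add: act_gen[of a "symbol b"] act_gen[of b "symbol a"])

text \<open>The central term is absent because \<open>(s, s) = 0\<close>.\<close>
lemma relation_s_s:
  "sigmak m (symbol (Loop Hs n)) * symbol (Loop Hs m)
   = sigmak n (symbol (Loop Hs m)) * symbol (Loop Hs n)"
  using bracket_relation[of "Loop Hs m" "Loop Hs n"]
  by (simp add: poly2_scale_conv in_s_const cong: if_cong)

lemma relation_d_loop:
  "sigmak m (symbol (Loop y n)) * symbol (Vir m)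
     - tauk (H4_charge y) (sigmak n (symbol (Vir m))) * symbol (Loop y n)
   = of_int n * symbol (Loop y (m + n))"
  using bracket_relation[of "Vir m" "Loop y n"]
  by (cases y) (simp_all add: act_single[of _ "of_int n"] poly2_scale_conv in_s_const)

lemma relation_d_d:
  "sigmak m (symbol (Vir n)) * symbol (Vir m) - sigmak n (symbol (Vir m)) * symbol (Vir n)
   = of_int (n - m) * symbol (Vir (m + n))
     + in_s [:if m + n = 0 then (of_int m ^ 3 - of_int m) / 12 else 0:] * symbol Cent"
  using bracket_relation[of "Vir m" "Vir n"]
  by (simp add: poly2_scale_conv in_s_const vir_def central_def del: fscale_single)

section \<open>The symbols of the currents of \<open>s\<close> and of the Virasoro operators\<close>

text \<open>Let \<open>h = (s \<otimes> t\<^sup>k)(s \<otimes> t\<^sup>-\<^sup>k).1\<close>. Exchanging the two commuting operators shows that \<open>h\<close> is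
  invariant under \<open>\<sigma>\<^sup>-\<^sup>k\<close>, hence free of \<open>d\<^sub>0\<close>, and so are its factors once \<open>h \<noteq> 0\<close>.\<close>
lemma symbol_s_in_s: "\<exists>g. symbol (Loop Hs k) = in_s g \<and> g \<noteq> 0"
proof (cases "k = 0")
  case True
  then show ?thesis
    using act_s[of 1] by (intro exI[of _ "[:0, 1:]"]) (auto simp: in_s_def var_s_def)
next
  case False
  define h where "h = symbol (Loop Hs k) * sigmak k (symbol (Loop Hs (- k)))"
  have nz: "symbol (Loop Hs l) \<noteq> 0" if "l \<noteq> 0" for l
  proof
    assume "symbol (Loop Hs l) = 0"
    then show False
      using relation_d_loop[of "- l" Hs l] that act_s[of 1] by (simp add: var_s_def)
  qed
  have "h \<noteq> 0"
  proof
    assume "h = 0"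
    then have "sigmak (- k) (sigmak k (symbol (Loop Hs (- k)))) = 0"
      using nz[OF False] by (simp add: h_def)
    then show False using nz[of "- k"] False by simp
  qed
  have "sigmak (- k) h = sigmak (- k) (symbol (Loop Hs k)) * symbol (Loop Hs (- k))"
    by (simp add: h_def)
  also have "\<dots> = h"
    using relation_s_s[of "- k" k] by (simp add: h_def mult.commute)
  finally obtain h' where "h = in_s h'"
    using in_s_of_sigmak_invariant[of "- k" h] False by auto
  with \<open>h \<noteq> 0\<close> obtain g where "symbol (Loop Hs k) = in_s g"
    unfolding h_def by (auto elim: in_s_factor)
  with nz[OF False] show ?thesis by auto
qed

text \<open>With \<open>S\<^sub>n \<in> \<complex>[s]\<close> the symbol of \<open>s \<otimes> t\<^sup>n\<close> and \<open>D\<^sub>m\<close> that of \<open>d\<^sub>m\<close>, the bracket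
  \<open>[d\<^sub>m, s \<otimes> t\<^sup>n]\<close> reads \<open>S\<^sub>n (D\<^sub>m - \<sigma>\<^sup>n(D\<^sub>m)) = n S\<^sub>m\<^sub>+\<^sub>n\<close>. For \<open>n = 1\<close> it makes
  \<open>D\<^sub>m = c\<^sub>m d\<^sub>0 + f\<^sub>m\<close> affine in \<open>d\<^sub>0\<close>, and in general it says \<open>S\<^sub>m\<^sub>+\<^sub>n = c\<^sub>m S\<^sub>n\<close> for \<open>n \<noteq> 0\<close>. Hence
  \<open>c\<^sub>1\<close> is a unit \<open>\<alpha>\<close>, and \<open>S\<^sub>0 = s\<close> fixes everything up to the \<open>f\<^sub>m\<close>, which the Virasoro relations
  determine.\<close>
lemma symbols_of_s_vir_central:
  obtains \<alpha> f where "\<alpha> \<noteq> 0"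
    "\<And>k. symbol (Loop Hs k) = in_s [:\<alpha> powi k:] * var_s"
    "\<And>k. symbol (Vir k) = in_s [:\<alpha> powi k:] * (var_d0 + of_int k * in_s f)"
    "symbol Cent = 0"
proof -
  obtain S where S: "symbol (Loop Hs k) = in_s (S k)" "S k \<noteq> 0" for k
    using symbol_s_in_s by metis
  have S0: "S 0 = [:0, 1:]"
    using act_s[of 1] S(1)[of 0] by (simp add: in_s_def var_s_def)
  have diff: "in_s (S n) * (symbol (Vir m) - sigmak n (symbol (Vir m))) = of_int n * in_s (S (m + n))"
    for m n
    using relation_d_loop[of m Hs n] by (simp add: S algebra_simps)
  have "\<exists>c f. symbol (Vir m) = in_s c * var_d0 + in_s f" for m
  proof -
    have "S (m + 1) \<noteq> 0"
      "(symbol (Vir m) - sigmak 1 (symbol (Vir m))) * in_s (S 1) = in_s (S (m + 1))"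
      using diff[of 1 m] S by (simp_all add: mult.commute)
    then obtain c where "symbol (Vir m) - sigmak 1 (symbol (Vir m)) = in_s c"
      using in_s_factor by metis
    then show ?thesis using affine_of_constant_difference by metis
  qed
  then obtain c f where cf: "symbol (Vir m) = in_s (c m) * var_d0 + in_s (f m)" for m
    by metis
  have rec: "S (m + n) = c m * S n" if "n \<noteq> 0" for m n
  proof -
    have "of_int n * in_s (S n * c m) = of_int n * in_s (S (m + n))"
      using diff[of n m] by (simp add: cf algebra_simps)
    then show ?thesis using that by (simp del: in_s_simps add: mult.commute)
  qed
  \<comment> \<open>Going from \<open>S\<^sub>1\<close> up to \<open>S\<^sub>2\<close> and back avoids the index \<open>0\<close>, where the recursion is void.\<close>
  have "S 1 * (c 1 * c (-1) - 1) = 0"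
    using rec[of 2 "-1"] rec[of 1 1] by (simp add: algebra_simps)
  then have cc: "c 1 * c (-1) = 1" using S(2)[of 1] by simp
  then obtain \<alpha> where \<alpha>: "c 1 = [:\<alpha>:]" "\<alpha> \<noteq> 0"
    by (metis dvd_triv_left is_unit_iff_degree degree_0_id mult_zero_left one_neq_zero pCons_0_0)
  have Ssuc: "S (n + 1) = [:\<alpha>:] * S n" for n
  proof (cases "n = 0")
    case True
    \<comment> \<open>The recursion does not start at \<open>S\<^sub>0\<close>, but it reaches \<open>S\<^sub>0\<close> from \<open>S\<^sub>1\<close>.\<close>
    have "S 0 = c (-1) * S 1" using rec[of 1 "-1"] by simp
    then have "c 1 * S 0 = (c 1 * c (-1)) * S 1" by (simp only: mult.assoc)
    then show ?thesis using True cc \<alpha>(1) by (metis add_0 mult_1)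
  next
    case False
    then show ?thesis using rec[of n 1] \<alpha> by (simp add: add.commute)
  qed
  have S_eq: "S k = [:\<alpha> powi k:] * [:0, 1:]" for k
  proof (induction k rule: int_induct[where k = 0])
    case (step1 i)
    then show ?case using Ssuc[of i] \<alpha> by (simp add: power_int_add_1')
  next
    case (step2 i)
    have "[:\<alpha>:] * S (i - 1) = [:\<alpha>:] * ([:\<alpha> powi (i - 1):] * [:0, 1:])"
      using step2 Ssuc[of "i - 1"] \<alpha> by (simp add: power_int_diff)
    then show ?case using \<alpha> by (simp only: mult_cancel_left) simp
  qed (simp add: S0)
  have c_eq: "c m = [:\<alpha> powi m:]" for m
  proof -
    have "c m * S 1 = [:\<alpha> powi m:] * S 1"
      using rec[of 1 m] \<alpha>(2) by (simp add: S_eq power_int_add_1 mult.commute)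
    then show ?thesis using S(2)[of 1] by (simp only: mult_cancel_right) simp
  qed
  define g where "g k = [:\<alpha> powi (- k):] * f k" for k
  have vir_eq: "symbol (Vir k) = in_s [:\<alpha> powi k:] * (var_d0 + in_s (g k))" for k
  proof -
    have "in_s [:\<alpha> powi k:] * in_s (g k) = in_s [:\<alpha> powi k * \<alpha> powi (- k):] * in_s (f k)"
      by (simp only: g_def in_s_simps in_s_const mult.assoc)
    also have "\<dots> = in_s (f k)"
      using \<alpha>(2) by (simp add: power_int_minus)
    finally show ?thesis by (simp only: cf c_eq distrib_left)
  qed
  have "symbol (Vir 0) = var_d0" using act_d0[of 1] by simp
  then have g0: "g 0 = 0" using vir_eq[of 0] by simp
  \<comment> \<open>In the relation for \<open>[d\<^sub>m, d\<^sub>n]\<close> all terms of positive degree in \<open>d\<^sub>0\<close> cancel, and the rest is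
    the cocycle equation up to the factor \<open>\<alpha>\<^sup>m\<^sup>+\<^sup>n\<close>.\<close>
  define \<kappa> where "\<kappa> = in_s [:1/12:] * symbol Cent"
  have cocycle: "of_int n * in_s (g n) - of_int m * in_s (g m) = of_int (n - m) * in_s (g (m + n))
      + (if m + n = 0 then of_int (m ^ 3 - m) * \<kappa> else 0)" for m n
  proof -
    have 12: "in_s [:(of_int m ^ 3 - of_int m) / 12:] * symbol Cent = of_int (m ^ 3 - m) * \<kappa>"
    proof -
      have "in_s [:(of_int m ^ 3 - of_int m) / 12:] = of_int (m ^ 3 - m) * in_s [:1/12:]"
        by (simp add: in_s_def of_int_poly)
      then show ?thesis by (simp only: \<kappa>_def mult.assoc)
    qed
    have "in_s [:\<alpha> powi (m + n):] * (of_int n * in_s (g n) - of_int m * in_s (g m)) =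
      in_s [:\<alpha> powi (m + n):] * (of_int (n - m) * in_s (g (m + n)))
      + (if m + n = 0 then of_int (m ^ 3 - m) * \<kappa> else 0)"
      using relation_d_d[of m n] \<alpha>(2) 12
      by (simp add: vir_eq power_int_add in_s_const algebra_simps)
    also have "\<dots> = in_s [:\<alpha> powi (m + n):] * (of_int (n - m) * in_s (g (m + n))
      + (if m + n = 0 then of_int (m ^ 3 - m) * \<kappa> else 0))"
      by (cases "m + n = 0") simp_all
    finally show ?thesis
      using \<alpha>(2) by (subst (asm) mult_left_cancel) simp_all
  qed
  note linear = witt_cocycle_linear[where g = "\<lambda>k. in_s (g k)", OF cocycle]
  have "\<kappa> = 0"
    by (rule linear(1)) (simp add: g0)
  then have K: "symbol Cent = 0"
    by (simp add: \<kappa>_def)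
  have vir_linear: "symbol (Vir k) = in_s [:\<alpha> powi k:] * (var_d0 + of_int k * in_s (g 1))" for k
    unfolding vir_eq by (subst linear(2)) (simp_all add: g0)
  have "symbol (Loop Hs k) = in_s [:\<alpha> powi k:] * var_s" for k
    unfolding S(1) S_eq by (simp add: in_s_def var_s_def)
  then show ?thesis
    using \<alpha>(2) vir_linear K that by blast
qed

lemma relation_s_loop:
  assumes "H4_charge y \<noteq> 0"
  shows "sigmak m (symbol (Loop y n)) * symbol (Loop Hs m)
     - tauk (H4_charge y) (sigmak n (symbol (Loop Hs m))) * symbol (Loop y n)
   = of_int (H4_charge y) * symbol (Loop y (m + n))"
  using bracket_relation[of "Loop Hs m" "Loop y n"] assms
  by (cases y) (simp_all add: poly2_scale_conv in_s_const central_def cong: if_cong)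

lemma act_eq_lin_ext: "act y x = lin_ext poly2_scale (\<lambda>b. act (nw_gen b) x) y"
proof (induction y rule: basis_induct)
  case zero
  show ?case by (simp add: lin_ext_def)
next
  case (add y z)
  interpret L: Vector_Spaces.linear fscale poly2_scale "lin_ext poly2_scale (\<lambda>b. act (nw_gen b) x)"
    by (rule linear_lin_ext[OF vector_space_poly2_scale])
  show ?case by (simp add: L.add add)
next
  case (single b c)
  show ?case
    by (simp add: lin_ext_single[OF vector_space_poly2_scale] act_single[of b c])
qed

end

section \<open>The symbols of the currents of \<open>p\<close>, \<open>q\<close> and \<open>r\<close>\<close>

text \<open>The parameters \<open>\<alpha>\<close> and \<open>f\<close> are those found in \<open>symbols_of_s_vir_central\<close>.\<close>
locale normalized_nw_module = polynomial_nw_module act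
  for act :: "nw \<Rightarrow> cpoly2 \<Rightarrow> cpoly2" and \<alpha> :: complex and f :: "complex poly" +
  assumes \<alpha>: "\<alpha> \<noteq> 0"
    and symbol_s: "symbol (Loop Hs k) = in_s [:\<alpha> powi k:] * var_s"
    and symbol_d: "symbol (Vir k) = in_s [:\<alpha> powi k:] * (var_d0 + of_int k * in_s f)"
    and symbol_central: "symbol Cent = 0"
begin

text \<open>Here \<open>y\<close> is \<open>p\<close> or \<open>q\<close> and \<open>j = \<plusminus>1\<close> is its charge. The bracket with \<open>s \<otimes> t\<^sup>m\<close> expresses
  the symbol of \<open>y \<otimes> t\<^sup>m\<close> by the symbol \<open>x\<close> of \<open>y\<close>. Passing from \<open>y\<close> to \<open>y \<otimes> t\<^sup>-\<^sup>1\<close> and back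
  multiplies by \<open>j\<^sup>2 = 1\<close>, and comparing with \<open>x\<close> leaves
  \<open>s (s - j) (2 x - \<sigma>(x) - \<sigma>\<^sup>-\<^sup>1(x)) = 0\<close>, so \<open>x = a d\<^sub>0 + b\<close>. The bracket \<open>[d\<^sub>m, y] = 0\<close> for
  \<open>m = \<plusminus>1\<close> gives \<open>a = 0\<close> and \<open>\<tau>\<^sup>j(f) b = f b\<close>.\<close>
lemma symbol_of_charged_loop:
  assumes j: "H4_charge y * H4_charge y = 1"
  obtains g where "\<And>k. symbol (Loop y k) = in_s [:\<alpha> powi k:] * in_s g"
    "f \<circ>\<^sub>p [:- of_int (H4_charge y), 1:] * g = f * g"
proof -
  define j x where "j = (of_int (H4_charge y) :: cpoly2)" and "x = symbol (Loop y 0)"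
  have jj: "j * (j * z) = z" for z
    using j by (simp add: j_def flip: of_int_mult mult.assoc)
  have "H4_charge y \<noteq> 0" using j by auto
  note rel = relation_s_loop[OF this]
  have raise: "in_s [:\<alpha> powi m:] * (var_s * sigmak m (symbol (Loop y n))
        - (var_s - j) * symbol (Loop y n))
      = j * symbol (Loop y (m + n))" for m n
    using rel[of m n] by (simp add: symbol_s j_def in_s_const algebra_simps)
  have y_eq: "symbol (Loop y m) = j * (in_s [:\<alpha> powi m:] * (var_s * sigmak m x - (var_s - j) * x))" for m
    using raise[of m 0] by (simp add: x_def jj)
  have "in_s [:\<alpha>:] * (var_s * sigmak 1 (symbol (Loop y (-1)))
      - (var_s - j) * symbol (Loop y (-1))) = j * x"
    using raise[of 1 "-1"] by (simp add: x_def)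
  moreover have "in_s [:\<alpha>:] * in_s [:inverse \<alpha>:] = 1"
    using \<alpha> by (simp flip: in_s_const(1))
  then have "in_s [:\<alpha>:] * (u * (j * (in_s [:inverse \<alpha>:] * v)) - w * (j * (in_s [:inverse \<alpha>:] * z)))
      = j * (u * v - w * z)" for u v w z
    by (simp add: right_diff_distrib ac_simps)
  ultimately have "j * (var_s * (var_s * x - (var_s - j) * sigmak 1 x)
      - (var_s - j) * (var_s * sigmak (-1) x - (var_s - j) * x)) = j * x"
    unfolding y_eq[of "-1"] by (simp add: j_def power_int_minus)
  then have "var_s * (var_s * x - (var_s - j) * sigmak 1 x)
      - (var_s - j) * (var_s * sigmak (-1) x - (var_s - j) * x) = x"
    using jj by metis
  moreover have "j * j = 1" using jj[of 1] by simp
  ultimately have "var_s * (var_s - j) * (2 * x - sigmak 1 x - sigmak (-1) x) = 0"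
    using jj[of x] by (simp add: algebra_simps)
  moreover have "var_s \<noteq> 0" "var_s - j \<noteq> 0"
    by (simp_all add: var_s_def j_def of_int_poly)
  ultimately have "2 * x - sigmak 1 x - sigmak (-1) x = 0"
    by simp
  then have "sigmak (-1) (x - sigmak 1 x) = x - sigmak 1 x"
    by (simp add: algebra_simps)
  then obtain a where "x - sigmak 1 x = in_s a"
    by (rule in_s_of_sigmak_invariant) simp
  then obtain b where x: "x = in_s a * var_d0 + in_s b"
    by (rule affine_of_constant_difference)
  define f' where "f' = f \<circ>\<^sub>p [:- of_int (H4_charge y), 1:]"
  have ab: "of_int m * (f * a - f' * a - a) = 0"
    "of_int m * (f * (b - of_int m * a) - f' * b) = 0" for m
  proof -
    have "in_s [:\<alpha> powi m:] * (sigmak m x * (var_d0 + of_int m * in_s f)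
        - (var_d0 + of_int m * in_s f') * x) = 0"
      using relation_d_loop[of m y 0]
      by (simp add: symbol_d f'_def in_s_const algebra_simps flip: x_def)
    then have "sigmak m x * (var_d0 + of_int m * in_s f) - (var_d0 + of_int m * in_s f') * x = 0"
      using \<alpha> by simp
    then have "in_s (of_int m * (f * a - f' * a - a)) * var_d0
        + in_s (of_int m * (f * (b - of_int m * a) - f' * b)) = 0"
      unfolding x by (simp add: f'_def algebra_simps)
    then show "of_int m * (f * a - f' * a - a) = 0"
      "of_int m * (f * (b - of_int m * a) - f' * b) = 0"
      using affine_eq_0 by blast+
  qed
  have "2 * (f * a) = 0"
    using ab(2)[of 1] ab(2)[of "-1"] by (simp add: algebra_simps)
  \<comment> \<open>If \<open>a \<noteq> 0\<close> then \<open>f = 0\<close>, but the coefficient of \<open>d\<^sub>0\<close> demands \<open>f - \<tau>\<^sup>j(f) = 1\<close>.\<close>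
  have "a = 0"
  proof (rule ccontr)
    assume "a \<noteq> 0"
    then have "f = 0" "f' = 0"
      using \<open>2 * (f * a) = 0\<close> by (simp_all add: f'_def)
    then show False using ab(1)[of 1] \<open>a \<noteq> 0\<close> by simp
  qed
  show ?thesis
  proof (rule that[of b])
    show "f \<circ>\<^sub>p [:- of_int (H4_charge y), 1:] * b = f * b"
      using ab(2)[of 1] \<open>a = 0\<close> by (auto simp: f'_def)
    fix k
    show "symbol (Loop y k) = in_s [:\<alpha> powi k:] * in_s b"
      unfolding y_eq x using \<open>a = 0\<close> jj jj[of 1] by (simp add: algebra_simps)
  qed
qed

text \<open>This is the bracket \<open>[p \<otimes> t\<^sup>k, q] = r \<otimes> t\<^sup>k\<close>; its central term vanishes with \<open>K\<close>.\<close>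
lemma symbol_r:
  assumes "\<And>k. symbol (Loop Hp k) = in_s [:\<alpha> powi k:] * in_s P"
    and "\<And>k. symbol (Loop Hq k) = in_s [:\<alpha> powi k:] * in_s Q"
  shows "symbol (Loop Hr k) = in_s [:\<alpha> powi k:] * in_s (Q \<circ>\<^sub>p [:-1, 1:] * P - P \<circ>\<^sub>p [:1, 1:] * Q)"
  using bracket_relation[of "Loop Hp k" "Loop Hq 0"] symbol_central
  by (simp add: assms poly2_scale_conv central_def algebra_simps cong: if_cong)

end

section \<open>Classification\<close>

text \<open>The second hypothesis is the bracket \<open>[p, r] = 0\<close> and makes \<open>R = c\<close> constant if \<open>P \<noteq> 0\<close>.
  Then \<open>W(s) = P(s + 1) Q(s)\<close> satisfies \<open>W(s - 1) = W(s) + c\<close>, so \<open>W + c s\<close> is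
  constant and \<open>deg P + deg Q = deg W \<le> 1\<close>.\<close>
lemma type_I_triples_of_relations:
  assumes R: "R = Q \<circ>\<^sub>p [:-1, 1:] * P - P \<circ>\<^sub>p [:1, 1:] * Q"
    and RP: "R \<circ>\<^sub>p [:-1, 1:] * P = R * P"
    and nz: "P \<noteq> 0 \<or> Q \<noteq> 0"
  shows "\<exists>c. R = [:c:] \<and> (P, Q, c) \<in> type_I_triples"
proof (cases "P = 0 \<or> Q = 0")
  case True
  then show ?thesis using R nz by (auto simp: type_I_triples_def)
next
  case False
  have "degree R = 0"
    using RP False by (intro degree_0_of_shift_invariant[of R "-1"]) auto
  then obtain c where c: "R = [:c:]" by (metis degree_0_id)
  define W where "W = P \<circ>\<^sub>p [:1, 1:] * Q"
  have "W \<circ>\<^sub>p [:-1, 1:] = Q \<circ>\<^sub>p [:-1, 1:] * P"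
    by (simp add: W_def pcompose_mult pcompose_assoc[symmetric] pcompose_pCons)
  also have "\<dots> = W + [:c:]"
    using R c by (simp add: W_def algebra_simps)
  finally have "(W + [:0, c:]) \<circ>\<^sub>p [:-1, 1:] = W + [:0, c:]"
    by (simp add: pcompose_add pcompose_pCons add.assoc)
  then have "degree (W + [:0, c:]) = 0"
    by (rule degree_0_of_shift_invariant) simp
  then obtain e where "W + [:0, c:] = [:e:]" by (metis degree_0_id)
  then have "W = [:e, - c:]" by (simp add: eq_diff_eq[symmetric])
  then have "degree P + degree Q \<le> 1"
    using False degree_mult_eq[of "P \<circ>\<^sub>p [:1, 1:]" Q]
    by (auto simp: W_def degree_pcompose pcompose_eq_0_iff split: if_splits)
  then have degs: "degree P \<le> 1 \<and> degree Q = 0 \<or> degree P = 0 \<and> degree Q \<le> 1"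
    by linarith
  have lin: "\<exists>a b. p = [:b, a:]" if "degree p \<le> 1" for p :: "complex poly"
    using that by (cases p) (auto split: if_splits elim!: degree_eq_zeroE)
  have const: "\<exists>b. p = [:b:]" if "degree p = 0" for p :: "complex poly"
    using that by (auto elim!: degree_eq_zeroE)
  from degs show ?thesis
  proof
    assume "degree P \<le> 1 \<and> degree Q = 0"
    then obtain a a2 b where PQ: "P = [:a2, a:]" "Q = [:b:]"
      using lin[of P] const[of Q] by auto
    then have "c = - a * b" using R c by (simp add: pcompose_pCons algebra_simps)
    then show ?thesis using c PQ False by (cases "a = 0") (auto simp: type_I_triples_def)
  next
    assume "degree P = 0 \<and> degree Q \<le> 1"
    then obtain a a2 b where PQ: "P = [:b:]" "Q = [:a2, a:]"
      using const[of P] lin[of Q] by auto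
    then have "c = - a * b" using R c by (simp add: pcompose_pCons algebra_simps)
    then show ?thesis using c PQ False by (cases "a = 0") (auto simp: type_I_triples_def)
  qed
qed

context normalized_nw_module
begin

lemma act_type_I_or_type_II:
  "(\<exists>l P Q R. (P \<noteq> 0 \<or> Q \<noteq> 0) \<and> (P, Q, R) \<in> type_I_triples \<and> act = type_I \<alpha> l P Q R)
    \<or> act = type_II \<alpha> f"
proof -
  obtain P where P: "\<And>k. symbol (Loop Hp k) = in_s [:\<alpha> powi k:] * in_s P"
      "f \<circ>\<^sub>p [:-1, 1:] * P = f * P"
    using symbol_of_charged_loop[of Hp] by auto
  obtain Q where Q: "\<And>k. symbol (Loop Hq k) = in_s [:\<alpha> powi k:] * in_s Q"
      "f \<circ>\<^sub>p [:1, 1:] * Q = f * Q"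
    using symbol_of_charged_loop[of Hq] by auto
  define R where "R = Q \<circ>\<^sub>p [:-1, 1:] * P - P \<circ>\<^sub>p [:1, 1:] * Q"
  note symbol_r_eq = symbol_r[OF P(1) Q(1), folded R_def]
  have R: "R \<circ>\<^sub>p [:-1, 1:] * P = R * P"
    using bracket_relation[of "Loop Hp 0" "Loop Hr 0"]
    by (simp add: P(1) symbol_r_eq del: in_s_simps(4) flip: in_s_simps(4))
  show ?thesis
  proof (cases "P = 0 \<and> Q = 0")
    case True
    have "act (nw_gen b) x = type_II_basis \<alpha> f b x" for b x
    proof (cases b)
      case (Loop y k)
      then show ?thesis
        unfolding act_gen[of b x]
        by (cases y; simp only: type_II_basis_sigmak)
           (simp_all add: symbol_s P(1) Q(1) symbol_r_eq True R_def)
    next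
      case (Vir k)
      then show ?thesis
        unfolding act_gen[of b x]
        by (simp only: type_II_basis_sigmak) (simp add: symbol_d)
    next
      case Cent
      then show ?thesis
        unfolding act_gen[of b x] by (simp add: symbol_central)
    qed
    then have "act y x = type_II \<alpha> f y x" for y x
      unfolding type_II_def by (subst act_eq_lin_ext) simp
    then have "act = type_II \<alpha> f" by blast
    then show ?thesis ..
  next
    case False
    then obtain c where c: "R = [:c:]" "(P, Q, c) \<in> type_I_triples"
      using type_I_triples_of_relations[OF R_def R] by auto
    have "degree f = 0"
    proof (cases "P = 0")
      case True
      then show ?thesis using Q(2) False by (intro degree_0_of_shift_invariant[of f 1]) auto
    next
      case False
      then show ?thesis using P(2) by (intro degree_0_of_shift_invariant[of f "-1"]) auto
    qed
    then obtain l where f: "f = [:l:]" by (metis degree_0_id)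
    have "act (nw_gen b) x = type_I_basis \<alpha> l P Q c b x" for b x
    proof (cases b)
      case (Loop y k)
      then show ?thesis
        unfolding act_gen[of b x]
        by (cases y; simp only: type_I_basis_sigmak)
           (simp_all add: symbol_s P(1) Q(1) symbol_r_eq f c(1))
    next
      case (Vir k)
      then show ?thesis
        unfolding act_gen[of b x]
        by (simp only: type_I_basis_sigmak) (simp add: symbol_d f)
    next
      case Cent
      then show ?thesis
        unfolding act_gen[of b x] by (simp add: symbol_central)
    qed
    then have "act y x = type_I \<alpha> l P Q c y x" for y x
      unfolding type_I_def by (subst act_eq_lin_ext) simp
    then have "act = type_I \<alpha> l P Q c" by blast
    then show ?thesis using False c(2) by blast
  qed
qed

end

section \<open>Reduction to modules on polynomials\<close>
lemma lie_module_isomorphic_transport: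
  assumes "lie_module lscale bracket scale act"
    and "Vector_Spaces.linear scale' scale \<phi>" "bij \<phi>"
  shows "lie_module_isomorphic lscale bracket scale act scale' (\<lambda>x v. inv \<phi> (act x (\<phi> v)))"
proof -
  interpret lie_module lscale bracket scale act by fact
  interpret L: Vector_Spaces.linear scale' scale \<phi> by fact
  interpret A: Vector_Spaces.linear lscale scale "\<lambda>x. act x v" for v by (rule act_linear_left)
  interpret B: Vector_Spaces.linear scale scale "act x" for x by (rule act_linear_right)
  have i [simp]: "inv \<phi> (\<phi> v) = v" "\<phi> (inv \<phi> w) = w" for v w
    using \<open>bij \<phi>\<close> by (simp_all add: bij_is_inj bij_is_surj surj_f_inv_f)
  have inv_lin: "inv \<phi> (v + w) = inv \<phi> v + inv \<phi> w" "inv \<phi> (scale c v) = scale' c (inv \<phi> v)"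
     "inv \<phi> (v - w) = inv \<phi> v - inv \<phi> w" for v w c
    using i(1)[of "inv \<phi> v + inv \<phi> w"] i(1)[of "scale' c (inv \<phi> v)"] i(1)[of "inv \<phi> v - inv \<phi> w"]
    by (simp_all only: L.add L.scale L.diff i(2))
  have "lie_module lscale bracket scale' (\<lambda>x v. inv \<phi> (act x (\<phi> v)))"
    by (intro lie_module.intro lie_module_axioms.intro lie_algebra_axioms L.vs1.vector_space_axioms)
       (simp_all add: linear_iff_pair L.vs1.vector_space_axioms vector_space_axioms inv_lin
         L.add L.scale A.add A.scale B.add B.scale act_bracket)
  moreover have "Vector_Spaces.linear scale scale' (inv \<phi>)"
    by (simp add: linear_iff_pair L.vs1.vector_space_axioms mod.vector_space_axioms inv_lin)
  ultimately show ?thesis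
    unfolding lie_module_isomorphic_def using assms(1) bij_imp_bij_inv[OF assms(3)]
    by (intro conjI exI[of _ "inv \<phi>"]) auto
qed

lemma nw_poly2_act_simps:
  assumes "lie_module fscale nw_bracket scale act"
  shows "nw_poly2_act scale act (in_s [:c:]) v = scale c v"
    "nw_poly2_act scale act var_s v = act (nw_gen (Loop Hs 0)) v"
    "nw_poly2_act scale act var_d0 v = act (nw_gen (Vir 0)) v"
proof -
  interpret lie_module fscale nw_bracket scale act by fact
  interpret B: Vector_Spaces.linear scale scale "act x" for x by (rule act_linear_right)
  show "nw_poly2_act scale act (in_s [:c:]) v = scale c v"
    "nw_poly2_act scale act var_s v = act (nw_gen (Loop Hs 0)) v"
    "nw_poly2_act scale act var_d0 v = act (nw_gen (Vir 0)) v"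
    by (simp_all add: nw_poly2_act_def poly2_act_def poly_act_def in_s_def var_s_def var_d0_def
        vir_def B.zero)
qed

text \<open>A basis vector \<open>v\<close> of the free module identifies \<open>\<complex>[s, d\<^sub>0]\<close> with the module by
  \<open>x \<mapsto> x.v\<close>, and this map turns the action of \<open>s\<close> and \<open>d\<^sub>0\<close> into multiplication.\<close>
lemma polynomial_model:
  assumes "lie_module fscale nw_bracket scale act"
    and "free_of_rank (nw_poly2_act scale act) 1"
  obtains act' where "polynomial_nw_module act'"
    "lie_module_isomorphic fscale nw_bracket scale act poly2_scale act'"
proof -
  interpret lie_module fscale nw_bracket scale act by fact
  interpret M: module "nw_poly2_act scale act" by (rule module_nw_poly2_act) fact
  note simps = nw_poly2_act_simps[OF assms(1)]
  obtain v where v: "\<not> M.dependent {v}" "M.span {v} = UNIV"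
    using assms(2) unfolding free_of_rank_def by (auto simp: card_1_singleton_iff)
  define \<phi> where "\<phi> x = nw_poly2_act scale act x v" for x
  have lin: "Vector_Spaces.linear poly2_scale scale \<phi>"
    unfolding linear_iff_pair[OF vector_space_poly2_scale mod.vector_space_axioms]
    by (simp add: \<phi>_def M.scale_left_distrib poly2_scale_conv simps flip: M.scale_scale)
  have "x = 0" if "\<phi> x = 0" for x
    using M.independentD[OF v(1), of "{v}" "\<lambda>_. x" v] that by (simp add: \<phi>_def)
  then have "inj \<phi>"
    by (intro injI) (metis \<phi>_def M.scale_left_diff_distrib right_minus_eq)
  moreover have "surj \<phi>"
    using v(2) by (simp add: M.span_singleton \<phi>_def[abs_def])
  ultimately have "bij \<phi>" by (simp add: bij_def)
  note iso = lie_module_isomorphic_transport[OF assms(1) lin this]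
  have i: "inv \<phi> (nw_poly2_act scale act y (\<phi> x)) = y * x" for x y
    using \<open>inj \<phi>\<close> by (metis \<phi>_def M.scale_scale inv_f_f)
  have "polynomial_nw_module (\<lambda>x v. inv \<phi> (act x (\<phi> v)))"
    using iso unfolding lie_module_isomorphic_def
    by (intro polynomial_nw_module.intro polynomial_nw_module_axioms.intro)
       (simp_all add: i flip: simps)
  then show ?thesis using that iso by blast
qed

theorem theorem4p12:
  fixes scale :: "complex \<Rightarrow> 'v::ab_group_add \<Rightarrow> 'v"
    and act :: "nw \<Rightarrow> 'v \<Rightarrow> 'v"
  assumes "lie_module fscale nw_bracket scale act"
    and "free_of_rank (nw_poly2_act scale act) 1"
  shows "(\<exists>\<alpha> l P Q R. \<alpha> \<noteq> 0 \<and> (P \<noteq> 0 \<or> Q \<noteq> 0) \<and> (P, Q, R) \<in> type_I_triples \<and>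
            lie_module_isomorphic fscale nw_bracket scale act poly2_scale (type_I \<alpha> l P Q R))
       \<or> (\<exists>\<alpha> f. \<alpha> \<noteq> 0 \<and>
            lie_module_isomorphic fscale nw_bracket scale act poly2_scale (type_II \<alpha> f))"
proof -
  obtain act' where act': "polynomial_nw_module act'"
    and iso: "lie_module_isomorphic fscale nw_bracket scale act poly2_scale act'"
    using polynomial_model[OF assms] .
  interpret polynomial_nw_module act' by fact
  obtain \<alpha> f where "normalized_nw_module act' \<alpha> f"
    using symbols_of_s_vir_central act'
    by (metis normalized_nw_module.intro normalized_nw_module_axioms.intro)
  then interpret normalized_nw_module act' \<alpha> f .
  show ?thesis using act_type_I_or_type_II \<alpha> iso by blast
qed

end
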